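(* The operad $Dup$ of duplicial algebras (over a field $\mathbb K$) is a Koszul operad.
   Context: A duplicial algebra is a vector space with two binary operations $\prec,\succ$ satisfying the three relations $(x\prec y)\prec z=x\prec(y\prec z)$, $(x\succ y)\prec z=x\succ(y\prec z)$, $(x\succ y)\succ z=x\succ(y\succ z)$. $Dup$ is the associated binary quadratic nonsymmetric operad. Koszul is meant in the sense of Ginzburg–Kapranov: the Koszul complex of the quadratic operad is acyclic; equivalently, the operadic homology of the free algebra $Dup(V)$ is $V$ in degree $1$ and $0$ in degrees $\ge2$. *)

theory Defs
  imports Complex_Main "HOL-Library.Tree" "HOL-Library.Poly_Mapping"
begin

section \<open>Linear algebra on finitely supported functions\<close>

definition smult :: "'k::field \<Rightarrow> ('b \<Rightarrow>\<^sub>0 'k) \<Rightarrow> ('b \<Rightarrow>\<^sub>0 'k)" where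
  "smult c f = Poly_Mapping.map ((*) c) f"

lemma lookup_smult: "Poly_Mapping.lookup (smult c f) b = c * Poly_Mapping.lookup f b"
  by (simp add: smult_def Poly_Mapping.map.rep_eq when_def)

global_interpretation fs: vector_space "smult :: 'k::field \<Rightarrow> ('b \<Rightarrow>\<^sub>0 'k) \<Rightarrow> ('b \<Rightarrow>\<^sub>0 'k)"
  by unfold_locales
    (rule poly_mapping_eqI, simp add: lookup_smult lookup_add algebra_simps)+

definition lin_ext :: "('b \<Rightarrow> ('c \<Rightarrow>\<^sub>0 'k)) \<Rightarrow> ('b \<Rightarrow>\<^sub>0 'k::field) \<Rightarrow> ('c \<Rightarrow>\<^sub>0 'k)" where
  "lin_ext \<phi> f = (\<Sum>b\<in>Poly_Mapping.keys f. smult (Poly_Mapping.lookup f b) (\<phi> b))"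

definition pairing :: "('b \<Rightarrow>\<^sub>0 'k::field) \<Rightarrow> ('b \<Rightarrow>\<^sub>0 'k) \<Rightarrow> 'k" where
  "pairing f h = (\<Sum>b\<in>Poly_Mapping.keys f. Poly_Mapping.lookup f b * Poly_Mapping.lookup h b)"


section \<open>Free nonsymmetric operad on binary generators, and operadic ideals\<close>

text \<open>
  For a finite set \<open>'g\<close> of binary generators, the free nonsymmetric operad \<open>T(E)\<close> on the
  vector space \<open>E\<close> with basis \<open>'g\<close> has as a basis the planar binary trees whose inner nodes are
  labelled by \<open>'g\<close>; the arity of a tree is its number of leaves \<^const>\<open>size1\<close>.  The dual basis
  identifies \<open>E\<^sup>*\<close> with \<open>E\<close>, so the same trees also serve as a basis of \<open>T(E\<^sup>*)\<close>.
\<close>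

definition free_op :: "nat \<Rightarrow> ('g tree \<Rightarrow>\<^sub>0 'k::field) set" where
  "free_op n = {f. \<forall>t\<in>Poly_Mapping.keys f. size1 t = n}"

text \<open>Leaves are numbered from 0, left to right; \<open>graft t i s\<close> is meant for \<open>i < size1 t\<close>.\<close>

fun graft :: "'g tree \<Rightarrow> nat \<Rightarrow> 'g tree \<Rightarrow> 'g tree" where
  "graft Leaf i s = s"
| "graft (Node l g r) i s =
     (if i < size1 l then Node (graft l i s) g r else Node l g (graft r (i - size1 l) s))"

definition pcomp :: "('g tree \<Rightarrow>\<^sub>0 'k::field) \<Rightarrow> nat \<Rightarrow> ('g tree \<Rightarrow>\<^sub>0 'k) \<Rightarrow> ('g tree \<Rightarrow>\<^sub>0 'k)" where
  "pcomp f i h = lin_ext (\<lambda>t. lin_ext (\<lambda>s. Poly_Mapping.single (graft t i s) 1) h) f"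

text \<open>\<open>in_ideal R n f\<close>: \<open>f\<close> lies in the arity \<open>n\<close> component of the operadic ideal \<open>(R)\<close> of
  \<open>T(E)\<close> generated by \<open>R\<close>.\<close>

inductive in_ideal :: "('g tree \<Rightarrow>\<^sub>0 'k::field) set \<Rightarrow> nat \<Rightarrow> ('g tree \<Rightarrow>\<^sub>0 'k) \<Rightarrow> bool"
  for R where
  gen: "f \<in> R \<Longrightarrow> f \<in> free_op n \<Longrightarrow> in_ideal R n f"
| zero: "in_ideal R n 0"
| add: "in_ideal R n f \<Longrightarrow> in_ideal R n h \<Longrightarrow> in_ideal R n (f + h)"
| scale: "in_ideal R n f \<Longrightarrow> in_ideal R n (smult c f)"
| comp_left: "in_ideal R n f \<Longrightarrow> h \<in> free_op m \<Longrightarrow> i < n \<Longrightarrow> in_ideal R (n + m - 1) (pcomp f i h)"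
| comp_right: "in_ideal R n f \<Longrightarrow> h \<in> free_op m \<Longrightarrow> i < m \<Longrightarrow> in_ideal R (m + n - 1) (pcomp h i f)"


section \<open>Koszul dual\<close>

text \<open>
  A set \<open>R\<close> of relators in \<open>T(E)(3)\<close> presents the binary quadratic operad \<open>P = T(E)/(R)\<close>.  Its
  Koszul dual operad is \<open>P\<^sup>! = T(E\<^sup>*)/(R\<^sup>\<bottom>)\<close>, where orthogonality is taken with respect to the
  pairing of \<open>T(E\<^sup>*)(3)\<close> with \<open>T(E)(3)\<close> that is \<open>+1\<close> on the basis elements \<open>\<mu> \<circ>\<^sub>1 \<nu>\<close> and
  \<open>-1\<close> on the basis elements \<open>\<mu> \<circ>\<^sub>2 \<nu>\<close>.
\<close>

definition quad_sign :: "'g tree \<Rightarrow> 'k::field" where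
  "quad_sign t = (if left t = Leaf then - 1 else 1)"

definition rel_perp :: "('g tree \<Rightarrow>\<^sub>0 'k::field) set \<Rightarrow> ('g tree \<Rightarrow>\<^sub>0 'k) set" where
  "rel_perp R = {f \<in> free_op 3. \<forall>r\<in>R. (\<Sum>t\<in>Poly_Mapping.keys f.
     quad_sign t * Poly_Mapping.lookup f t * Poly_Mapping.lookup r t) = 0}"

text \<open>
  The linear dual of \<open>P\<^sup>!(k) = T(E\<^sup>*)(k)/(R\<^sup>\<bottom>)(k)\<close> is the annihilator of \<open>(R\<^sup>\<bottom>)(k)\<close> in
  \<open>T(E)(k)\<close>, since \<open>T(E)(k)\<close> is finite dimensional.
\<close>

definition koszul_dual_lin :: "('g::finite tree \<Rightarrow>\<^sub>0 'k::field) set \<Rightarrow> nat \<Rightarrow> ('g tree \<Rightarrow>\<^sub>0 'k) set" where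
  "koszul_dual_lin R k = {x \<in> free_op k. \<forall>f. in_ideal (rel_perp R) k f \<longrightarrow> pairing x f = 0}"


section \<open>Koszul complex\<close>

text \<open>
  The Koszul complex in arity \<open>n\<close> has in degree \<open>k\<close> the space
  \[ \bigoplus_{i_1 + \dots + i_k = n} P^!(k)^* \otimes P(i_1) \otimes \dots \otimes P(i_k) . \]
  It is represented as a quotient of subspaces of the space with basis the pairs \<open>(t, ts)\<close>, where
  \<open>t\<close> is a tree with \<open>k\<close> leaves and \<open>ts\<close> is a list of \<open>k\<close> trees with \<open>n\<close> leaves in total:
  \<open>koszul_num\<close> is the sum of the \<open>P\<^sup>!(k)\<^sup>* \<otimes> T(E)(i\<^sub>1) \<otimes> \<dots> \<otimes> T(E)(i\<^sub>k)\<close>, and \<open>koszul_den\<close> is the kernel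
  of its projection, spanned by the tensors with one factor \<open>T(E)(i\<^sub>j)\<close> taken from \<open>(R)(i\<^sub>j)\<close>.
  Homological degree \<open>k\<close> is that of the operadic homology \<open>H\<^sub>k\<close>, so that \<open>k = 1\<close> is the lowest one.
\<close>

definition tensor_trees ::
  "('g tree \<Rightarrow>\<^sub>0 'k::field) \<Rightarrow> 'g tree list \<Rightarrow> ('g tree \<times> 'g tree list \<Rightarrow>\<^sub>0 'k)" where
  "tensor_trees x ts = lin_ext (\<lambda>t. Poly_Mapping.single (t, ts) 1) x"

definition tensor_at ::
  "('g tree \<Rightarrow>\<^sub>0 'k::field) \<Rightarrow> 'g tree list \<Rightarrow> nat \<Rightarrow> ('g tree \<Rightarrow>\<^sub>0 'k)
     \<Rightarrow> ('g tree \<times> 'g tree list \<Rightarrow>\<^sub>0 'k)" where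
  "tensor_at x ts j f = lin_ext (\<lambda>s. tensor_trees x (ts[j := s])) f"

definition koszul_num ::
  "('g::finite tree \<Rightarrow>\<^sub>0 'k::field) set \<Rightarrow> nat \<Rightarrow> nat \<Rightarrow> ('g tree \<times> 'g tree list \<Rightarrow>\<^sub>0 'k) set" where
  "koszul_num R k n = fs.span {tensor_trees x ts | x ts.
     x \<in> koszul_dual_lin R k \<and> length ts = k \<and> sum_list (map size1 ts) = n}"

definition koszul_den ::
  "('g::finite tree \<Rightarrow>\<^sub>0 'k::field) set \<Rightarrow> nat \<Rightarrow> nat \<Rightarrow> ('g tree \<times> 'g tree list \<Rightarrow>\<^sub>0 'k) set" where
  "koszul_den R k n = fs.span {tensor_at x ts j f | x ts j f.
     x \<in> koszul_dual_lin R k \<and> length ts = k \<and> sum_list (map size1 ts) = n \<and>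
     j < k \<and> in_ideal R (size1 (ts ! j)) f}"

text \<open>
  \<open>splits t\<close> lists the ways to write \<open>t = t' \<circ>\<^sub>i g\<close> with a generator \<open>g\<close>.  Summing over it gives the
  transpose of the partial compositions \<open>P\<^sup>!(k) \<otimes> E\<^sup>* \<rightarrow> P\<^sup>!(k + 1)\<close>, and the differential composes
  the split-off generator with the two adjacent factors from \<open>P\<close>:
  \<open>d = \<Sum>\<^sub>i (-1)\<^sup>i d\<^sub>i\<close>.
\<close>

definition splits :: "'g tree \<Rightarrow> (nat \<times> 'g \<times> 'g tree) set" where
  "splits t = {(i, g, t'). i < size1 t' \<and> graft t' i (Node Leaf g Leaf) = t}"

definition koszul_diff_basis ::
  "'g tree \<times> 'g tree list \<Rightarrow> ('g tree \<times> 'g tree list \<Rightarrow>\<^sub>0 'k::field)" where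
  "koszul_diff_basis = (\<lambda>(t, ts). \<Sum>(i, g, t')\<in>splits t.
     Poly_Mapping.single
       (t', take i ts @ [Node (ts ! i) g (ts ! Suc i)] @ drop (i + 2) ts) ((- 1) ^ i))"

definition koszul_diff ::
  "('g tree \<times> 'g tree list \<Rightarrow>\<^sub>0 'k::field) \<Rightarrow> ('g tree \<times> 'g tree list \<Rightarrow>\<^sub>0 'k)" where
  "koszul_diff = lin_ext koszul_diff_basis"

text \<open>\<^const>\<open>splits\<close> is finite, so the sum above is a genuine one.\<close>

lemma size_graft_cherry: "size (graft t i (Node Leaf g Leaf)) = Suc (size t)"
  by (induction t arbitrary: i) auto

lemma set_tree_graft: "i < size1 t \<Longrightarrow> set_tree (graft t i s) = set_tree t \<union> set_tree s"
  by (induction t arbitrary: i) auto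

lemma finite_trees_of_size: "finite A \<Longrightarrow> finite {t. set_tree t \<subseteq> A \<and> size t \<le> n}"
proof (induction n)
  case 0
  have "{t. set_tree t \<subseteq> A \<and> size t \<le> 0} \<subseteq> {Leaf}" by auto
  then show ?case by (rule finite_subset) simp
next
  case (Suc n)
  let ?S = "{t. set_tree t \<subseteq> A \<and> size t \<le> n}"
  have "{t. set_tree t \<subseteq> A \<and> size t \<le> Suc n} \<subseteq>
      insert Leaf ((\<lambda>(l, g, r). Node l g r) ` (?S \<times> A \<times> ?S))"
  proof
    fix t assume "t \<in> {t. set_tree t \<subseteq> A \<and> size t \<le> Suc n}"
    then show "t \<in> insert Leaf ((\<lambda>(l, g, r). Node l g r) ` (?S \<times> A \<times> ?S))"
      by (cases t) (auto simp: image_iff)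
  qed
  moreover have "finite ?S" using Suc by simp
  ultimately show ?case
    using Suc.prems by (meson finite.insertI finite_SigmaI finite_imageI finite_subset)
qed

lemma finite_splits: "finite (splits t)"
proof -
  have "splits t \<subseteq> {..size t} \<times> set_tree t \<times> {u. set_tree u \<subseteq> set_tree t \<and> size u \<le> size t}"
    by (auto simp: splits_def set_tree_graft size_graft_cherry size1_size)
  then show ?thesis
    by (rule finite_subset) (simp add: finite_trees_of_size)
qed

text \<open>Cycles and boundaries of the quotient complex, as subspaces containing \<^const>\<open>koszul_den\<close>.\<close>

definition koszul_cycles ::
  "('g::finite tree \<Rightarrow>\<^sub>0 'k::field) set \<Rightarrow> nat \<Rightarrow> nat \<Rightarrow> ('g tree \<times> 'g tree list \<Rightarrow>\<^sub>0 'k) set" where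
  "koszul_cycles R k n = {z \<in> koszul_num R k n. koszul_diff z \<in> koszul_den R (k - 1) n}"

definition koszul_boundaries ::
  "('g::finite tree \<Rightarrow>\<^sub>0 'k::field) set \<Rightarrow> nat \<Rightarrow> nat \<Rightarrow> ('g tree \<times> 'g tree list \<Rightarrow>\<^sub>0 'k) set" where
  "koszul_boundaries R k n =
     {koszul_diff y + u | y u. y \<in> koszul_num R (Suc k) n \<and> u \<in> koszul_den R k n}"

text \<open>
  Acyclicity means that the homology is the identity operad.  In arity 1 the complex is just
  \<open>P\<^sup>!(1)\<^sup>* \<otimes> P(1) = \<bbbK>\<close>, in degree 1, so the condition concerns the arities \<open>n \<ge> 2\<close> only.
\<close>

definition koszul :: "('g::finite tree \<Rightarrow>\<^sub>0 'k::field) set \<Rightarrow> bool" where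
  "koszul R \<longleftrightarrow> (\<forall>n\<ge>2. \<forall>k. koszul_cycles R k n = koszul_boundaries R k n)"


section \<open>The operad of duplicial algebras\<close>

datatype dup_op = Prec | Succ

instance dup_op :: finite
proof
  have "(UNIV :: dup_op set) = {Prec, Succ}" using dup_op.exhaust by auto
  then show "finite (UNIV :: dup_op set)" by (metis finite.emptyI finite.insertI)
qed

text \<open>\<open>assoc_relator a b\<close> encodes the relation \<open>(x a y) b z = x a (y b z)\<close>.\<close>

definition assoc_relator :: "'g \<Rightarrow> 'g \<Rightarrow> ('g tree \<Rightarrow>\<^sub>0 'k::field)" where
  "assoc_relator a b =
     Poly_Mapping.single (Node (Node Leaf a Leaf) b Leaf) 1
     - Poly_Mapping.single (Node Leaf a (Node Leaf b Leaf)) 1"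

definition dup_relators :: "(dup_op tree \<Rightarrow>\<^sub>0 'k::field) set" where
  "dup_relators = {assoc_relator Prec Prec, assoc_relator Succ Prec, assoc_relator Succ Succ}"

end

theory Submission
  imports Defs
begin

text \<open>
  In arity \<open>k\<close> the Koszul dual operad has as a basis the words \<open>\<succ>\<^sup>a \<prec>\<^sup>b\<close> with \<open>a + b = k - 1\<close>: an
  element of the dual cooperad has equal coefficients on all trees with the same inorder, and
  coefficient 0 if some \<open>\<prec>\<close> precedes some \<open>\<succ>\<close>.  The free duplicial algebra on one generator is the
  span of the nonempty binary trees, with \<open>\<succ>\<close> and \<open>\<prec>\<close> grafting on the leftmost, respectively
  rightmost, leaf.  So the Koszul complex is the total complex of a double complex
  \<open>A\<^bsup>\<otimes>(a+b+1)\<^esup>\<close> in which adjacent factors are multiplied by \<open>\<succ>\<close> in the first \<open>a\<close> places and by \<open>\<prec>\<close>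
  in the last \<open>b\<close> ones.  Since \<open>(A, \<succ>)\<close> is a free associative algebra, and its indecomposables form
  a free right module of rank one over \<open>(A, \<prec>)\<close>, splitting the first factor is a contracting
  homotopy in every arity \<open>n \<ge> 2\<close>.
\<close>

subsection \<open>Linear extension\<close>

lemma lin_ext_superset:
  assumes "finite S" "Poly_Mapping.keys f \<subseteq> S"
  shows "lin_ext \<phi> f = (\<Sum>b\<in>S. smult (Poly_Mapping.lookup f b) (\<phi> b))"
  unfolding lin_ext_def
  by (rule sum.mono_neutral_left[OF assms]) (auto simp: in_keys_iff)

lemma lin_ext_add: "lin_ext \<phi> (f + g) = lin_ext \<phi> f + lin_ext \<phi> g"
proof -
  let ?S = "Poly_Mapping.keys f \<union> Poly_Mapping.keys g"
  have "Poly_Mapping.keys (f + g) \<subseteq> ?S" by (rule keys_add)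
  then show ?thesis
    by (simp add: lin_ext_superset[of ?S] lookup_add fs.scale_left_distrib sum.distrib)
qed

lemma lin_ext_smult: "lin_ext \<phi> (smult c f) = smult c (lin_ext \<phi> f)"
proof -
  have "Poly_Mapping.keys (smult c f) \<subseteq> Poly_Mapping.keys f"
    by (auto simp: in_keys_iff lookup_smult)
  then show ?thesis
    by (simp add: lin_ext_superset[of "Poly_Mapping.keys f"] lookup_smult fs.scale_sum_right)
qed

lemma lin_ext_zero [simp]: "lin_ext \<phi> 0 = 0"
  by (simp add: lin_ext_def)

lemma lin_ext_single: "lin_ext \<phi> (Poly_Mapping.single b c) = smult c (\<phi> b)"
  by (cases "c = 0") (simp_all add: lin_ext_def)

lemma lin_ext_single_one [simp]: "lin_ext \<phi> (Poly_Mapping.single b 1) = \<phi> b"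
  by (simp add: lin_ext_single)

lemma lin_ext_uminus: "lin_ext \<phi> (- f) = - lin_ext \<phi> f"
  using lin_ext_add[of \<phi> f "- f"] by (simp add: eq_neg_iff_add_eq_0 add.commute)

lemma lin_ext_diff: "lin_ext \<phi> (f - g) = lin_ext \<phi> f - lin_ext \<phi> g"
  using lin_ext_add[of \<phi> f "- g"] by (simp add: lin_ext_uminus)

lemma lin_ext_sum: "lin_ext \<phi> (\<Sum>i\<in>I. f i) = (\<Sum>i\<in>I. lin_ext \<phi> (f i))"
  by (induction I rule: infinite_finite_induct) (simp_all add: lin_ext_add)

lemmas lin_ext_linear = lin_ext_add lin_ext_smult lin_ext_uminus lin_ext_diff lin_ext_sum

lemma lin_ext_lin_ext: "lin_ext \<phi> (lin_ext \<psi> f) = lin_ext (\<lambda>b. lin_ext \<phi> (\<psi> b)) f"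
  by (simp add: lin_ext_def[of \<psi>] lin_ext_def[of "\<lambda>b. lin_ext \<phi> (\<psi> b)"] lin_ext_linear)

lemma lin_ext_fun_zero [simp]: "lin_ext (\<lambda>b. 0) f = 0"
  by (simp add: lin_ext_def)

lemma lin_ext_fun_add: "lin_ext (\<lambda>b. \<phi> b + \<psi> b) f = lin_ext \<phi> f + lin_ext \<psi> f"
  by (simp add: lin_ext_def fs.scale_right_distrib sum.distrib)

lemma lin_ext_fun_diff: "lin_ext (\<lambda>b. \<phi> b - \<psi> b) f = lin_ext \<phi> f - lin_ext \<psi> f"
  by (simp add: lin_ext_def fs.scale_right_diff_distrib sum_subtractf)

lemma lookup_sum_poly: "Poly_Mapping.lookup (\<Sum>i\<in>I. f i) b = (\<Sum>i\<in>I. Poly_Mapping.lookup (f i) b)"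
  by (induction I rule: infinite_finite_induct) (simp_all add: lookup_add)

lemma lin_ext_id: "lin_ext (\<lambda>b. Poly_Mapping.single b 1) f = f"
proof (rule poly_mapping_eqI)
  fix b
  have "Poly_Mapping.lookup (lin_ext (\<lambda>b. Poly_Mapping.single b 1) f) b
    = (\<Sum>a\<in>Poly_Mapping.keys f. if a = b then Poly_Mapping.lookup f a else 0)"
    unfolding lin_ext_def lookup_sum_poly lookup_smult
    by (rule sum.cong) (auto simp: lookup_single when_def)
  also have "\<dots> = Poly_Mapping.lookup f b"
    by (simp add: in_keys_iff)
  finally show "Poly_Mapping.lookup (lin_ext (\<lambda>b. Poly_Mapping.single b 1) f) b = Poly_Mapping.lookup f b" .
qed

lemma lin_ext_cong:
  "(\<And>b. b \<in> Poly_Mapping.keys f \<Longrightarrow> \<phi> b = \<psi> b) \<Longrightarrow> lin_ext \<phi> f = lin_ext \<psi> f"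
  by (simp add: lin_ext_def)

lemma lin_ext_eq_on_span:
  assumes "z \<in> fs.span S" "\<And>s. s \<in> S \<Longrightarrow> lin_ext \<phi> s = lin_ext \<psi> s"
  shows "lin_ext \<phi> z = lin_ext \<psi> z"
proof -
  have "fs.span S \<subseteq> {z. lin_ext \<phi> z = lin_ext \<psi> z}"
    by (rule fs.span_minimal) (auto simp: assms(2) fs.subspace_def lin_ext_linear)
  then show ?thesis using assms(1) by auto
qed

lemma lin_ext_in_span:
  assumes "z \<in> fs.span S" "\<And>s. s \<in> S \<Longrightarrow> lin_ext \<phi> s \<in> fs.span T"
  shows "lin_ext \<phi> z \<in> fs.span T"
proof -
  have "fs.span S \<subseteq> {z. lin_ext \<phi> z \<in> fs.span T}"
    by (rule fs.span_minimal)
      (auto simp: assms(2) fs.subspace_def lin_ext_linear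
        intro: fs.span_zero fs.span_add fs.span_scale)
  then show ?thesis using assms(1) by auto
qed

lemma keys_lin_ext: "Poly_Mapping.keys (lin_ext \<phi> f) \<subseteq> (\<Union>b\<in>Poly_Mapping.keys f. Poly_Mapping.keys (\<phi> b))"
proof
  fix c assume "c \<in> Poly_Mapping.keys (lin_ext \<phi> f)"
  then have "(\<Sum>b\<in>Poly_Mapping.keys f. Poly_Mapping.lookup f b * Poly_Mapping.lookup (\<phi> b) c) \<noteq> 0"
    by (simp add: in_keys_iff lin_ext_def lookup_sum_poly lookup_smult)
  then obtain b where "b \<in> Poly_Mapping.keys f" "Poly_Mapping.lookup f b * Poly_Mapping.lookup (\<phi> b) c \<noteq> 0"
    by (meson sum.not_neutral_contains_not_neutral)
  then show "c \<in> (\<Union>b\<in>Poly_Mapping.keys f. Poly_Mapping.keys (\<phi> b))"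
    by (auto simp: in_keys_iff)
qed


subsection \<open>Operadic ideals\<close>

lemma size1_graft: "i < size1 t \<Longrightarrow> size1 (graft t i s) + 1 = size1 t + size1 s"
  by (induction t arbitrary: i) auto

lemma pcomp_single:
  "pcomp (Poly_Mapping.single t 1) i (Poly_Mapping.single s 1) = Poly_Mapping.single (graft t i s) 1"
  by (simp add: pcomp_def)

lemma pcomp_diff_left: "pcomp (f - g) i h = pcomp f i h - pcomp g i h"
  by (simp add: pcomp_def lin_ext_linear)

lemma pcomp_diff_right: "pcomp f i (g - h) = pcomp f i g - pcomp f i h"
  by (simp add: pcomp_def lin_ext_linear lin_ext_fun_diff)

lemma keys_pcomp:
  "Poly_Mapping.keys (pcomp f i h)
    \<subseteq> (\<lambda>(t, s). graft t i s) ` (Poly_Mapping.keys f \<times> Poly_Mapping.keys h)"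
proof
  fix u assume "u \<in> Poly_Mapping.keys (pcomp f i h)"
  then obtain t where t: "t \<in> Poly_Mapping.keys f"
    "u \<in> Poly_Mapping.keys (lin_ext (\<lambda>s. Poly_Mapping.single (graft t i s) 1) h)"
    unfolding pcomp_def using keys_lin_ext by fastforce
  then obtain s where "s \<in> Poly_Mapping.keys h" "u = graft t i s"
    using keys_lin_ext by fastforce
  with t show "u \<in> (\<lambda>(t, s). graft t i s) ` (Poly_Mapping.keys f \<times> Poly_Mapping.keys h)"
    by auto
qed

lemma free_op_single: "Poly_Mapping.single t c \<in> free_op (size1 t)"
  by (auto simp: free_op_def split: if_splits)

lemma free_op_add: "f \<in> free_op n \<Longrightarrow> g \<in> free_op n \<Longrightarrow> f + g \<in> free_op n"
  using keys_add[of f g] by (auto simp: free_op_def)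

lemma free_op_uminus: "f \<in> free_op n \<Longrightarrow> - f \<in> free_op n"
  by (simp add: free_op_def)

lemma free_op_diff: "f \<in> free_op n \<Longrightarrow> g \<in> free_op n \<Longrightarrow> f - g \<in> free_op n"
  using free_op_add[of f n "- g"] free_op_uminus[of g n] by simp

lemma free_op_smult: "f \<in> free_op n \<Longrightarrow> smult c f \<in> free_op n"
  by (auto simp: free_op_def in_keys_iff lookup_smult)

lemma free_op_pcomp:
  assumes "f \<in> free_op n" "h \<in> free_op m" "i < n"
  shows "pcomp f i h \<in> free_op (n + m - 1)"
  unfolding free_op_def
proof safe
  fix u assume "u \<in> Poly_Mapping.keys (pcomp f i h)"
  then obtain t s where "t \<in> Poly_Mapping.keys f" "s \<in> Poly_Mapping.keys h" "u = graft t i s"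
    using keys_pcomp by fastforce
  with assms size1_graft[of i t s] show "size1 u = n + m - 1"
    by (auto simp: free_op_def)
qed

lemma in_ideal_free_op: "in_ideal R n f \<Longrightarrow> f \<in> free_op n"
proof (induction rule: in_ideal.induct)
  case (zero n) show ?case by (simp add: free_op_def)
qed (simp_all add: free_op_add free_op_smult free_op_pcomp del: One_nat_def)

text \<open>The last two assumptions make the kernel of \<open>lin_ext F\<close> an operadic ideal:
  \<open>F\<close> of a graft depends linearly on \<open>F\<close> of either factor, the other being
  fixed. A kernel that contains \<open>R\<close> then contains \<open>(R)\<close>. This gives the
  lower bounds for both quotient operads.\<close>

lemma in_ideal_lin_ext_zero:
  assumes ideal: "in_ideal R n f"
    and gen: "\<And>r. r \<in> R \<Longrightarrow> lin_ext F r = 0"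
    and left: "\<And>i s. \<exists>G. \<forall>t. i < size1 t \<longrightarrow> F (graft t i s) = lin_ext G (F t)"
    and right: "\<And>i t. i < size1 t \<Longrightarrow> \<exists>G. \<forall>s. F (graft t i s) = lin_ext G (F s)"
  shows "lin_ext F f = 0"
  using ideal
proof (induction rule: in_ideal.induct)
  case (comp_left n f h m i)
  from left obtain G where G: "\<And>i s t. i < size1 t \<Longrightarrow> F (graft t i s) = lin_ext (G i s) (F t)"
    by metis
  have fr: "f \<in> free_op n" using comp_left in_ideal_free_op by blast
  have "lin_ext F (pcomp f i h) = lin_ext (\<lambda>t. lin_ext (\<lambda>s. F (graft t i s)) h) f"
    by (simp add: pcomp_def lin_ext_lin_ext)
  also have "\<dots> = lin_ext (\<lambda>t. lin_ext (\<lambda>s. lin_ext (G i s) (F t)) h) f"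
    using fr comp_left by (intro lin_ext_cong) (auto simp: free_op_def G)
  \<comment> \<open>The sums are exchanged because \<open>G i s\<close> depends on \<open>s\<close>
    but not on \<open>t\<close>; it then comes out of the sum over \<open>t\<close> and meets
    \<open>lin_ext F f\<close>, which is zero by induction.\<close>
  also have "\<dots> = (\<Sum>s\<in>Poly_Mapping.keys h. smult (Poly_Mapping.lookup h s)
      (lin_ext (\<lambda>t. lin_ext (G i s) (F t)) f))"
    unfolding lin_ext_def[of _ h] lin_ext_def[of _ f] fs.scale_sum_right
    by (subst sum.swap) (simp add: mult.commute)
  also have "\<dots> = (\<Sum>s\<in>Poly_Mapping.keys h. smult (Poly_Mapping.lookup h s)
      (lin_ext (G i s) (lin_ext F f)))"
    by (simp add: lin_ext_lin_ext)
  finally show ?case using comp_left by simp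
next
  case (comp_right n f h m i)
  from right obtain G where G: "\<And>i t s. i < size1 t \<Longrightarrow> F (graft t i s) = lin_ext (G i t) (F s)"
    by metis
  have "lin_ext F (pcomp h i f) = lin_ext (\<lambda>t. lin_ext (\<lambda>s. F (graft t i s)) f) h"
    by (simp add: pcomp_def lin_ext_lin_ext)
  also have "\<dots> = lin_ext (\<lambda>t. lin_ext (G i t) (lin_ext F f)) h"
  proof (rule lin_ext_cong)
    fix t assume "t \<in> Poly_Mapping.keys h"
    with comp_right have "i < size1 t" by (auto simp: free_op_def)
    then show "lin_ext (\<lambda>s. F (graft t i s)) f = lin_ext (G i t) (lin_ext F f)"
      by (simp add: G lin_ext_lin_ext)
  qed
  finally show ?case using comp_right by simp
qed (auto simp: gen lin_ext_linear)

section \<open>Congruence of trees modulo an operadic ideal\<close>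

definition tree_cong :: "('g tree \<Rightarrow>\<^sub>0 'k::field) set \<Rightarrow> 'g tree \<Rightarrow> 'g tree \<Rightarrow> bool" where
  "tree_cong R t t' \<longleftrightarrow> size1 t = size1 t' \<and>
     in_ideal R (size1 t) (Poly_Mapping.single t 1 - Poly_Mapping.single t' 1)"

lemma in_ideal_diff: "in_ideal R n f \<Longrightarrow> in_ideal R n g \<Longrightarrow> in_ideal R n (f - g)"
  using in_ideal.add[of R n f "smult (- 1) g"] in_ideal.scale[of R n g "- 1"] by simp

lemma tree_cong_refl [simp]: "tree_cong R t t"
  by (simp add: tree_cong_def in_ideal.zero)

lemma tree_cong_sym: "tree_cong R t t' \<Longrightarrow> tree_cong R t' t"
  using in_ideal_diff[OF in_ideal.zero, of R "size1 t" "Poly_Mapping.single t 1 - Poly_Mapping.single t' 1"]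
  by (auto simp: tree_cong_def)

lemma tree_cong_trans [trans]: "tree_cong R t u \<Longrightarrow> tree_cong R u v \<Longrightarrow> tree_cong R t v"
  using in_ideal.add[of R "size1 t" "Poly_Mapping.single t 1 - Poly_Mapping.single u 1"
      "Poly_Mapping.single u 1 - Poly_Mapping.single v 1"]
  by (auto simp: tree_cong_def)

lemma tree_cong_graft_left:
  assumes "tree_cong R t t'" "i < size1 t"
  shows "tree_cong R (graft t i s) (graft t' i s)"
proof -
  have "in_ideal R (size1 t + size1 s - 1)
      (pcomp (Poly_Mapping.single t 1 - Poly_Mapping.single t' 1) i (Poly_Mapping.single s 1))"
    using assms free_op_single by (intro in_ideal.comp_left) (auto simp: tree_cong_def)
  moreover have "size1 (graft t i s) = size1 t + size1 s - 1" "size1 (graft t' i s) = size1 t + size1 s - 1"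
    using assms size1_graft[of i t s] size1_graft[of i t' s] by (auto simp: tree_cong_def)
  ultimately show ?thesis
    by (simp add: tree_cong_def pcomp_diff_left pcomp_single)
qed

lemma tree_cong_graft_right:
  assumes "tree_cong R s s'" "i < size1 t"
  shows "tree_cong R (graft t i s) (graft t i s')"
proof -
  have "in_ideal R (size1 t + size1 s - 1)
      (pcomp (Poly_Mapping.single t 1) i (Poly_Mapping.single s 1 - Poly_Mapping.single s' 1))"
    using assms free_op_single by (intro in_ideal.comp_right) (auto simp: tree_cong_def)
  moreover have "size1 (graft t i s) = size1 t + size1 s - 1" "size1 (graft t i s') = size1 t + size1 s - 1"
    using assms size1_graft[of i t s] size1_graft[of i t s'] by (auto simp: tree_cong_def)
  ultimately show ?thesis
    by (simp add: tree_cong_def pcomp_diff_right pcomp_single)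
qed

lemma tree_cong_Node:
  assumes "tree_cong R l l'" "tree_cong R r r'"
  shows "tree_cong R (Node l g r) (Node l' g r')"
proof -
  have "tree_cong R (Node l g r) (Node l' g r)"
    using tree_cong_graft_right[OF assms(1), of 0 "Node Leaf g r"] by simp
  also have "tree_cong R (Node l' g r) (Node l' g r')"
    using tree_cong_graft_right[OF assms(2), of "size1 l'" "Node l' g Leaf"] by simp
  finally show ?thesis .
qed

lemma tree_cong_assoc:
  assumes "assoc_relator a b \<in> R"
  shows "tree_cong R (Node (Node x a y) b z) (Node x a (Node y b z))"
proof -
  have "tree_cong R (Node (Node Leaf a Leaf) b Leaf) (Node Leaf a (Node Leaf b Leaf))"
    unfolding tree_cong_def using assms
    by (auto simp: assoc_relator_def numeral_eq_Suc intro!: in_ideal.gen free_op_diff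
        free_op_single[of "Node (Node Leaf a Leaf) b Leaf", simplified, unfolded numeral_eq_Suc, simplified]
        free_op_single[of "Node Leaf a (Node Leaf b Leaf)", simplified, unfolded numeral_eq_Suc, simplified])
  \<comment> \<open>The three leaves are filled from right to left, so that the leaf numbers still
    to be used do not shift.\<close>
  from tree_cong_graft_left[OF this, of 2 z]
  have "tree_cong R (Node (Node Leaf a Leaf) b z) (Node Leaf a (Node Leaf b z))" by simp
  from tree_cong_graft_left[OF this, of 1 y]
  have "tree_cong R (Node (Node Leaf a y) b z) (Node Leaf a (Node y b z))" by simp
  from tree_cong_graft_left[OF this, of 0 x] show ?thesis by simp
qed


subsection \<open>The Koszul dual of the duplicial operad\<close>

text \<open>The words \<open>Succ\<^sup>a Prec\<^sup>b\<close>; they index a basis of the Koszul dual.\<close>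

definition dup_word :: "dup_op list \<Rightarrow> bool" where
  "dup_word w \<longleftrightarrow> sorted_wrt (\<lambda>a b. a = Prec \<longrightarrow> b = Prec) w"

lemma dup_word_Nil [simp]: "dup_word []"
  by (simp add: dup_word_def)

lemma dup_word_Cons: "dup_word (a # w) \<longleftrightarrow> (a = Prec \<longrightarrow> set w \<subseteq> {Prec}) \<and> dup_word w"
  by (auto simp: dup_word_def)

text \<open>In contrapositive form: inserting a word into a forbidden one, or a forbidden word
  anywhere, gives a forbidden word.\<close>

lemma dup_word_insertD: "dup_word (u @ v @ w) \<Longrightarrow> dup_word (u @ w) \<and> dup_word v"
  by (auto simp: dup_word_def sorted_wrt_append)

text \<open>For admissible \<open>w\<close> these are the elements of the dual cooperad that are
  dual to the basis of words: pairing with one of them extracts the coefficient of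
  \<open>w\<close>.\<close>

definition word_sum :: "'g list \<Rightarrow> ('g tree \<Rightarrow>\<^sub>0 'k::field)" where
  "word_sum w = (\<Sum>t | inorder t = w. Poly_Mapping.single t 1)"

text \<open>The right comb is the chosen representative of all trees with a given inorder.\<close>

fun comb :: "'g list \<Rightarrow> 'g tree" where
  "comb [] = Leaf"
| "comb (a # w) = Node Leaf a (comb w)"

lemma inorder_comb [simp]: "inorder (comb w) = w"
  by (induction w) auto

lemma size1_eq_length_inorder: "size1 t = Suc (length (inorder t))"
  by (simp add: size1_size)

lemma size1_comb [simp]: "size1 (comb w) = Suc (length w)"
  by (simp add: size1_eq_length_inorder)

lemma finite_inorder_eq: "finite {t. inorder t = w}"
proof (rule finite_subset)
  show "{t. inorder t = w} \<subseteq> {t. set_tree t \<subseteq> set w \<and> size t \<le> length w}"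
    by (auto simp flip: set_inorder length_inorder)
qed (simp add: finite_trees_of_size)

lemma lookup_word_sum:
  "Poly_Mapping.lookup (word_sum w) t = (if inorder t = w then 1 else 0)"
  by (simp add: word_sum_def lookup_sum_poly lookup_single when_def finite_inorder_eq)

lemma keys_word_sum: "Poly_Mapping.keys (word_sum w :: _ \<Rightarrow>\<^sub>0 'k::field) = {t. inorder t = w}"
  by (auto simp: in_keys_iff lookup_word_sum split: if_splits)

text \<open>Leaf \<open>i\<close> lies in gap \<open>i\<close> of the inorder word, so partial
  composition of trees becomes insertion of words.\<close>

lemma inorder_graft:
  "i < size1 t \<Longrightarrow> inorder (graft t i s) = take i (inorder t) @ inorder s @ drop i (inorder t)"
proof (induction t arbitrary: i)
  case (Node l g r)
  show ?case
  proof (cases "i < size1 l")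
    case True
    with Node.IH(1) show ?thesis by (simp add: size1_size)
  next
    case False
    then obtain j where j: "i = size1 l + j" by (metis le_add_diff_inverse not_less)
    with Node show ?thesis by (simp add: size1_size)
  qed
qed simp

lemma trees_size1_3:
  fixes t :: "dup_op tree"
  assumes "size1 t = 3"
  obtains a b where "t = Node (Node Leaf a Leaf) b Leaf" | a b where "t = Node Leaf a (Node Leaf b Leaf)"
proof (cases t)
  case (Node l g r)
  with assms have "size l + size r = 1" by (simp add: size1_size)
  then consider "size l = 0" "size r = 1" | "size l = 1" "size r = 0" by linarith
  then show ?thesis
  proof cases
    case 1
    then obtain h where "r = Node Leaf h Leaf" by (cases r) auto
    with 1 Node that show ?thesis by simp
  next
    case 2
    then obtain h where "l = Node Leaf h Leaf" by (cases l) auto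
    with 2 Node that show ?thesis by simp
  qed
qed (use assms in simp)

section \<open>Orthogonal relations and the span of the dual cooperad\<close>

definition trees3 :: "dup_op tree set" where
  "trees3 = (\<Union>a\<in>{Prec, Succ}. \<Union>b\<in>{Prec, Succ}.
     {Node (Node Leaf a Leaf) b Leaf, Node Leaf a (Node Leaf b Leaf)})"

lemma keys_subset_trees3: "f \<in> free_op 3 \<Longrightarrow> Poly_Mapping.keys f \<subseteq> trees3"
proof
  fix t assume "f \<in> free_op 3" "t \<in> Poly_Mapping.keys f"
  then have "size1 t = 3" by (simp add: free_op_def)
  then show "t \<in> trees3"
    by (elim trees_size1_3) (auto simp: trees3_def intro: dup_op.exhaust)
qed

text \<open>The sign of the pairing on the right-leaning tree cancels the minus sign in the relator,
  so both coefficients enter with a plus.\<close>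

lemma rel_perp_sum:
  assumes "f \<in> free_op 3"
  shows "(\<Sum>t\<in>Poly_Mapping.keys f. quad_sign t * Poly_Mapping.lookup f t *
      Poly_Mapping.lookup (assoc_relator a b :: dup_op tree \<Rightarrow>\<^sub>0 'k::field) t)
    = Poly_Mapping.lookup f (Node (Node Leaf a Leaf) b Leaf)
      + Poly_Mapping.lookup f (Node Leaf a (Node Leaf b Leaf))"
proof -
  have "(\<Sum>t\<in>Poly_Mapping.keys f. quad_sign t * Poly_Mapping.lookup f t *
      Poly_Mapping.lookup (assoc_relator a b) t)
    = (\<Sum>t\<in>trees3. quad_sign t * Poly_Mapping.lookup f t *
      Poly_Mapping.lookup (assoc_relator a b) t)"
    using keys_subset_trees3[OF assms]
    by (intro sum.mono_neutral_left) (auto simp: trees3_def in_keys_iff)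
  then show ?thesis
    by (cases a; cases b)
      (simp_all add: trees3_def assoc_relator_def lookup_minus lookup_single quad_sign_def)
qed

text \<open>The three relators are the \<open>assoc_relator a b\<close> for admissible two-letter
  words. The pair \<open>Prec\<close>, \<open>Succ\<close> is left unconstrained, so both of its
  tree monomials are orthogonal to the relators.\<close>

lemma rel_perp_dup_iff:
  fixes f :: "dup_op tree \<Rightarrow>\<^sub>0 'k::field"
  shows "f \<in> rel_perp dup_relators \<longleftrightarrow> f \<in> free_op 3 \<and>
    (\<forall>a b. dup_word [a, b] \<longrightarrow> Poly_Mapping.lookup f (Node (Node Leaf a Leaf) b Leaf)
      + Poly_Mapping.lookup f (Node Leaf a (Node Leaf b Leaf)) = 0)"
proof -
  have eq: "(dup_relators :: (_ \<Rightarrow>\<^sub>0 'k) set) = {assoc_relator a b | a b. dup_word [a, b]}"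
    by (auto simp: dup_relators_def dup_word_Cons) (metis dup_op.exhaust)+
  show ?thesis
    unfolding rel_perp_def eq
    by (auto simp: rel_perp_sum) (subst rel_perp_sum[symmetric], assumption, blast)
qed

lemma assoc_relator_free_op: "assoc_relator a b \<in> free_op 3"
  by (auto simp: assoc_relator_def free_op_def dest!: keys_diff[THEN subsetD] split: if_splits)

text \<open>Hence in the Koszul dual all four associativity relations hold, and a tree matters there
  only through its inorder.\<close>

lemma assoc_relator_in_rel_perp: "assoc_relator a b \<in> rel_perp dup_relators"
  by (auto simp: rel_perp_dup_iff assoc_relator_free_op)
    (auto simp: assoc_relator_def lookup_minus lookup_single when_def)

abbreviation dual_ideal :: "nat \<Rightarrow> (dup_op tree \<Rightarrow>\<^sub>0 'k::field) \<Rightarrow> bool" where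
  "dual_ideal \<equiv> in_ideal (rel_perp dup_relators)"

lemma tree_cong_comb_append:
  "tree_cong (rel_perp (dup_relators :: (_ \<Rightarrow>\<^sub>0 'k::field) set)) (Node (comb u) g (comb v)) (comb (u @ g # v))"
proof (induction u)
  case (Cons a u)
  have "tree_cong (rel_perp (dup_relators :: (_ \<Rightarrow>\<^sub>0 'k) set))
      (Node (comb (a # u)) g (comb v)) (Node Leaf a (Node (comb u) g (comb v)))"
    by (simp add: tree_cong_assoc assoc_relator_in_rel_perp)
  also have "tree_cong (rel_perp (dup_relators :: (_ \<Rightarrow>\<^sub>0 'k) set)) \<dots> (Node Leaf a (comb (u @ g # v)))"
    by (rule tree_cong_Node) (simp_all add: Cons)
  finally show ?case by simp
qed simp

lemma tree_cong_comb:
  "tree_cong (rel_perp (dup_relators :: (_ \<Rightarrow>\<^sub>0 'k::field) set)) t (comb (inorder t))"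
proof (induction t)
  case (Node l g r)
  have "tree_cong (rel_perp (dup_relators :: (_ \<Rightarrow>\<^sub>0 'k) set)) (Node l g r)
      (Node (comb (inorder l)) g (comb (inorder r)))"
    by (rule tree_cong_Node) (rule Node)+
  also have "tree_cong (rel_perp (dup_relators :: (_ \<Rightarrow>\<^sub>0 'k) set)) \<dots> (comb (inorder (Node l g r)))"
    using tree_cong_comb_append by simp
  finally show ?case .
qed simp

text \<open>A forbidden word has a \<open>Prec\<close> immediately followed by a
  \<open>Succ\<close>, and the two-node comb on these letters is itself a dual relator. The
  induction strips letters until this pair is in front.\<close>

lemma not_dup_word_comb:
  "\<not> dup_word w \<Longrightarrow> dual_ideal (Suc (length w)) (Poly_Mapping.single (comb w) (1::'k::field))"
proof (induction w)
  case (Cons a w)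
  show ?case
  proof (cases "dup_word w")
    case False
    have "in_ideal (rel_perp dup_relators) (size1 (Node Leaf a Leaf) + Suc (length w) - 1)
        (pcomp (Poly_Mapping.single (Node Leaf a Leaf) 1) 1 (Poly_Mapping.single (comb w) (1::'k)))"
      using Cons False by (intro in_ideal.comp_right free_op_single) auto
    then show ?thesis by (simp add: pcomp_single)
  next
    case True
    with Cons.prems have a: "a = Prec" "\<not> set w \<subseteq> {Prec}" by (auto simp: dup_word_Cons)
    then obtain b v where w: "w = b # v" by (cases w) auto
    \<comment> \<open>An admissible word starting with \<open>Prec\<close> would consist of
      \<open>Prec\<close> alone, against the choice of \<open>w\<close>.\<close>
    have b: "b = Succ" using a True w by (cases b) (auto simp: dup_word_Cons)
    let ?t = "Node Leaf Prec (Node Leaf Succ Leaf)"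
    have 1: "Poly_Mapping.single ?t (1::'k) \<in> rel_perp dup_relators"
      using free_op_single[of ?t "1::'k"]
      by (auto simp: rel_perp_dup_iff dup_word_Cons lookup_single when_def numeral_3_eq_3)
    have "in_ideal (rel_perp dup_relators) (size1 ?t + Suc (length v) - 1)
        (pcomp (Poly_Mapping.single ?t 1) 2 (Poly_Mapping.single (comb v) (1::'k)))"
      using free_op_single[of "comb v" "1::'k"]
      by (intro in_ideal.comp_left in_ideal.gen 1 free_op_single) auto
    then show ?thesis using a b w by (simp add: pcomp_single)
  qed
qed simp

section \<open>Words as a model of the Koszul dual\<close>

definition word_class :: "dup_op tree \<Rightarrow> (dup_op list \<Rightarrow>\<^sub>0 'k::field)" where
  "word_class t = (if dup_word (inorder t) then Poly_Mapping.single (inorder t) 1 else 0)"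

text \<open>The class of a graft is computed by inserting words, and \<open>dup_word_insertD\<close>
  makes a zero class of either factor force a zero class of the graft. So the admissible words stay
  linearly independent in the Koszul dual.\<close>

lemma dual_ideal_word_class:
  assumes "dual_ideal n (f :: _ \<Rightarrow>\<^sub>0 'k::field)"
  shows "lin_ext word_class f = (0 :: _ \<Rightarrow>\<^sub>0 'k)"
  using assms
proof (rule in_ideal_lin_ext_zero)
  fix r :: "dup_op tree \<Rightarrow>\<^sub>0 'k" assume r: "r \<in> rel_perp dup_relators"
  then have free: "r \<in> free_op 3" by (simp add: rel_perp_dup_iff)
  have eq: "Poly_Mapping.lookup r (Node (Node Leaf a Leaf) b Leaf)
      = - Poly_Mapping.lookup r (Node Leaf a (Node Leaf b Leaf))" if "dup_word [a, b]" for a b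
    using r that by (simp add: rel_perp_dup_iff eq_neg_iff_add_eq_0)
  show "lin_ext word_class r = (0 :: _ \<Rightarrow>\<^sub>0 'k)"
    by (subst lin_ext_superset[OF _ keys_subset_trees3[OF free]])
      (simp_all add: trees3_def word_class_def eq dup_word_Cons)
next
  fix i :: nat and s
  define G :: "dup_op list \<Rightarrow> (dup_op list \<Rightarrow>\<^sub>0 'k)" where
    "G w = (let u = take i w @ inorder s @ drop i w in
      if dup_word u then Poly_Mapping.single u 1 else 0)" for w
  have "word_class (graft t i s) = lin_ext G (word_class t)" if "i < size1 t" for t
    using dup_word_insertD[of "take i (inorder t)" "inorder s" "drop i (inorder t)"] that
    by (simp add: word_class_def inorder_graft G_def Let_def)
  then show "\<exists>G. \<forall>t. i < size1 t \<longrightarrow> word_class (graft t i s) = lin_ext G (word_class t :: _ \<Rightarrow>\<^sub>0 'k)"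
    by blast
next
  fix i :: nat and t :: "dup_op tree" assume i: "i < size1 t"
  define G :: "dup_op list \<Rightarrow> (dup_op list \<Rightarrow>\<^sub>0 'k)" where
    "G w = (let u = take i (inorder t) @ w @ drop i (inorder t) in
      if dup_word u then Poly_Mapping.single u 1 else 0)" for w
  have "word_class (graft t i s) = lin_ext G (word_class s)" for s
    using dup_word_insertD[of "take i (inorder t)" "inorder s" "drop i (inorder t)"] i
    by (simp add: word_class_def inorder_graft G_def Let_def)
  then show "\<exists>G. \<forall>s. word_class (graft t i s) = lin_ext G (word_class s :: _ \<Rightarrow>\<^sub>0 'k)"
    by blast
qed

lemma pairing_word_sum:
  assumes "dup_word w"
  shows "pairing (word_sum w) f = Poly_Mapping.lookup (lin_ext word_class f) w"
proof -
  have "pairing (word_sum w) f = (\<Sum>t | inorder t = w. Poly_Mapping.lookup f t)"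
    by (simp add: pairing_def keys_word_sum lookup_word_sum)
  also have "\<dots> = (\<Sum>t\<in>Poly_Mapping.keys f \<union> {t. inorder t = w}.
      if inorder t = w then Poly_Mapping.lookup f t else 0)"
    by (rule sum.mono_neutral_cong_left) (auto simp: finite_inorder_eq)
  also have "\<dots> = (\<Sum>t\<in>Poly_Mapping.keys f. if inorder t = w then Poly_Mapping.lookup f t else 0)"
    by (rule sum.mono_neutral_right) (auto simp: finite_inorder_eq in_keys_iff)
  also have "\<dots> = Poly_Mapping.lookup (lin_ext word_class f) w"
    unfolding lin_ext_def lookup_sum_poly lookup_smult
    by (rule sum.cong) (auto simp: word_class_def assms lookup_single when_def)
  finally show ?thesis .
qed

lemma word_sum_in_dual:
  assumes "dup_word w"
  shows "word_sum w \<in> koszul_dual_lin (dup_relators :: (_ \<Rightarrow>\<^sub>0 'k::field) set) (Suc (length w))"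
  using assms
  by (auto simp: koszul_dual_lin_def free_op_def keys_word_sum size1_eq_length_inorder
      pairing_word_sum dual_ideal_word_class)

lemma pairing_single: "pairing x (Poly_Mapping.single t 1) = Poly_Mapping.lookup x t"
proof -
  have "pairing x (Poly_Mapping.single t 1)
      = (\<Sum>b\<in>Poly_Mapping.keys x. if b = t then Poly_Mapping.lookup x b else 0)"
    unfolding pairing_def by (rule sum.cong) (auto simp: lookup_single when_def)
  then show ?thesis by (simp add: in_keys_iff)
qed

lemma pairing_diff: "pairing x (f - g) = pairing x f - pairing x g"
  by (simp add: pairing_def lookup_minus algebra_simps sum_subtractf)

text \<open>Orthogonality to differences of trees with equal inorder makes the coefficients of
  \<open>x\<close> constant on such trees; orthogonality to forbidden combs makes the remaining ones
  vanish.\<close>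

lemma koszul_dual_lin_subset:
  assumes x: "x \<in> koszul_dual_lin (dup_relators :: (_ \<Rightarrow>\<^sub>0 'k::field) set) k"
  shows "x \<in> fs.span {word_sum w | w. dup_word w \<and> Suc (length w) = k}"
proof -
  have free: "x \<in> free_op k" and orth: "\<And>f. dual_ideal k f \<Longrightarrow> pairing x f = 0"
    using x by (auto simp: koszul_dual_lin_def)
  define W where "W = {w :: dup_op list. dup_word w \<and> Suc (length w) = k}"
  have finW: "finite W"
    by (rule finite_subset[OF _ finite_lists_length_eq[of UNIV "k - 1"]]) (auto simp: W_def)
  have comb: "Poly_Mapping.lookup x t = Poly_Mapping.lookup x (comb (inorder t))" if "size1 t = k" for t
  proof -
    have "dual_ideal k (Poly_Mapping.single t 1 - Poly_Mapping.single (comb (inorder t)) (1::'k))"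
      using tree_cong_comb that unfolding tree_cong_def by blast
    from orth[OF this] show ?thesis by (simp add: pairing_diff pairing_single)
  qed
  have zero: "Poly_Mapping.lookup x t = 0" if "size1 t = k" "\<not> dup_word (inorder t)" for t
  proof -
    have "dual_ideal k (Poly_Mapping.single (comb (inorder t)) (1::'k))"
      using not_dup_word_comb[OF that(2), where 'k = 'k] that(1)
      by (simp add: size1_eq_length_inorder del: length_inorder)
    from orth[OF this] comb[OF that(1)] show ?thesis by (simp add: pairing_single)
  qed
  \<comment> \<open>By constancy, the coefficient of \<open>word_sum w\<close> can be read at the
    comb.\<close>
  have "x = (\<Sum>w\<in>W. smult (Poly_Mapping.lookup x (comb w)) (word_sum w))"
  proof (rule poly_mapping_eqI)
    fix t
    have "Poly_Mapping.lookup (\<Sum>w\<in>W. smult (Poly_Mapping.lookup x (comb w)) (word_sum w)) t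
        = (\<Sum>w\<in>W. if inorder t = w then Poly_Mapping.lookup x (comb w) else 0)"
      unfolding lookup_sum_poly lookup_smult lookup_word_sum by (rule sum.cong) auto
    also have "\<dots> = (if inorder t \<in> W then Poly_Mapping.lookup x (comb (inorder t)) else 0)"
      using finW by simp
    also have "\<dots> = Poly_Mapping.lookup x t"
    proof (cases "size1 t = k")
      case True
      then show ?thesis
        using comb[of t] zero[of t] by (auto simp: W_def size1_size)
    next
      case False
      then have "t \<notin> Poly_Mapping.keys x" using free by (auto simp: free_op_def)
      then show ?thesis using False by (auto simp: W_def size1_size in_keys_iff)
    qed
    finally show "Poly_Mapping.lookup x t
      = Poly_Mapping.lookup (\<Sum>w\<in>W. smult (Poly_Mapping.lookup x (comb w)) (word_sum w)) t" by simp
  qed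
  also have "\<dots> \<in> fs.span {word_sum w | w. dup_word w \<and> Suc (length w) = k}"
    by (intro fs.span_sum fs.span_scale fs.span_base) (auto simp: W_def)
  finally show ?thesis .
qed


subsection \<open>The free duplicial algebra on one generator\<close>

text \<open>Its basis consists of the nonempty binary trees, the one-node tree being the generator;
  \<^const>\<open>Leaf\<close> is not a basis element.\<close>

fun over :: "unit tree \<Rightarrow> unit tree \<Rightarrow> unit tree" where
  "over x Leaf = x"
| "over x (Node l u r) = Node (over x l) u r"

fun under :: "unit tree \<Rightarrow> unit tree \<Rightarrow> unit tree" where
  "under Leaf y = y"
| "under (Node l u r) y = Node l u (under r y)"

fun dup_mult :: "dup_op \<Rightarrow> unit tree \<Rightarrow> unit tree \<Rightarrow> unit tree" where
  "dup_mult Prec x y = under x y"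
| "dup_mult Succ x y = over x y"

lemma size_over [simp]: "size (over x y) = size x + size y"
  by (induction y) auto

lemma size_under [simp]: "size (under x y) = size x + size y"
  by (induction x) auto

lemma size_dup_mult [simp]: "size (dup_mult g x y) = size x + size y"
  by (cases g) auto

lemma over_Leaf [simp]: "over Leaf y = y"
  by (induction y) auto

lemma under_Leaf [simp]: "under x Leaf = x"
  by (induction x) auto

lemma over_assoc: "over (over x y) z = over x (over y z)"
  by (induction z) auto

lemma under_assoc: "under (under x y) z = under x (under y z)"
  by (induction x) auto

text \<open>For empty \<open>y\<close> the sides would be \<open>under x z\<close> and
  \<open>over x z\<close>; this is why \<open>Leaf\<close> is kept out of the basis.\<close>

lemma over_under: "y \<noteq> Leaf \<Longrightarrow> under (over x y) z = over x (under y z)"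
  by (cases y) auto

lemma over_eq_Leaf_iff [simp]: "over x y = Leaf \<longleftrightarrow> x = Leaf \<and> y = Leaf"
  by (cases y) auto

lemma under_eq_Leaf_iff [simp]: "under x y = Leaf \<longleftrightarrow> x = Leaf \<and> y = Leaf"
  by (cases x) auto

lemma dup_mult_eq_Leaf_iff [simp]: "dup_mult g x y = Leaf \<longleftrightarrow> x = Leaf \<and> y = Leaf"
  by (cases g) auto

lemma dup_mult_assoc:
  "dup_word [a, b] \<Longrightarrow> y \<noteq> Leaf \<Longrightarrow> dup_mult b (dup_mult a x y) z = dup_mult a x (dup_mult b y z)"
  by (cases a; cases b) (auto simp: over_assoc under_assoc over_under dup_word_Cons)

text \<open>The value of a tree monomial with the generator in every input. For a nonsymmetric
  operad the arity \<open>n\<close> component is the degree \<open>n\<close> part of the free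
  algebra on one generator.\<close>

fun ev :: "dup_op tree \<Rightarrow> unit tree" where
  "ev Leaf = Node Leaf () Leaf"
| "ev (Node l g r) = dup_mult g (ev l) (ev r)"

lemma ev_not_Leaf [simp]: "ev t \<noteq> Leaf"
  by (induction t) auto

lemma size_ev [simp]: "size (ev t) = size1 t"
  by (induction t) auto

text \<open>A section of \<open>ev\<close> on nonempty trees: \<open>y\<close> with subtrees
  \<open>l\<close> and \<open>r\<close> is written as \<open>l\<close> \<succ> (generator \<prec>
  \<open>r\<close>), with empty factors omitted. The value at \<open>Leaf\<close> is a
  dummy.\<close>

fun rep :: "unit tree \<Rightarrow> dup_op tree" where
  "rep Leaf = Leaf"
| "rep (Node l u r) =
     (let s = (if r = Leaf then Leaf else Node Leaf Prec (rep r))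
      in if l = Leaf then s else Node (rep l) Succ s)"

lemma ev_rep: "y \<noteq> Leaf \<Longrightarrow> ev (rep y) = y"
  by (induction y) (auto simp: Let_def)

lemma size1_rep: "y \<noteq> Leaf \<Longrightarrow> size1 (rep y) = size y"
  using size_ev[of "rep y"] by (simp add: ev_rep)

section \<open>Normal forms modulo the duplicial relations\<close>

abbreviation dup_cong :: "'k::field itself \<Rightarrow> dup_op tree \<Rightarrow> dup_op tree \<Rightarrow> bool" where
  "dup_cong _ \<equiv> tree_cong (dup_relators :: (_ \<Rightarrow>\<^sub>0 'k::field) set)"

lemma dup_cong_assoc:
  "dup_word [a, b] \<Longrightarrow> dup_cong TYPE('k::field) (Node (Node x a y) b z) (Node x a (Node y b z))"
  by (cases a; cases b) (auto simp: dup_word_Cons dup_relators_def intro!: tree_cong_assoc)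

lemma rep_over:
  "x \<noteq> Leaf \<Longrightarrow> y \<noteq> Leaf \<Longrightarrow>
    dup_cong TYPE('k::field) (rep (over x y)) (Node (rep x) Succ (rep y))"
proof (induction y)
  case (Node l u r)
  let ?s = "if r = Leaf then Leaf else Node Leaf Prec (rep r)"
  show ?case
  proof (cases "l = Leaf")
    case False
    with Node have "dup_cong TYPE('k) (Node (rep (over x l)) Succ ?s) (Node (Node (rep x) Succ (rep l)) Succ ?s)"
      by (intro tree_cong_Node) auto
    also have "dup_cong TYPE('k) \<dots> (Node (rep x) Succ (Node (rep l) Succ ?s))"
      by (rule dup_cong_assoc) (simp add: dup_word_Cons)
    finally show ?thesis using False by (simp add: Let_def)
  qed (use Node in \<open>simp add: Let_def\<close>)
qed simp

lemma rep_under: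
  "x \<noteq> Leaf \<Longrightarrow> y \<noteq> Leaf \<Longrightarrow>
    dup_cong TYPE('k::field) (rep (under x y)) (Node (rep x) Prec (rep y))"
proof (induction x)
  case (Node l u r)
  let ?s = "if r = Leaf then Leaf else Node Leaf Prec (rep r)"
  have s: "dup_cong TYPE('k) (Node Leaf Prec (rep (under r y))) (Node ?s Prec (rep y))"
  proof (cases "r = Leaf")
    case False
    with Node have "dup_cong TYPE('k) (Node Leaf Prec (rep (under r y)))
        (Node Leaf Prec (Node (rep r) Prec (rep y)))"
      by (intro tree_cong_Node) auto
    also have "dup_cong TYPE('k) \<dots> (Node (Node Leaf Prec (rep r)) Prec (rep y))"
      by (rule tree_cong_sym, rule dup_cong_assoc) (simp add: dup_word_Cons)
    finally show ?thesis using False by simp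
  qed simp
  show ?case
  proof (cases "l = Leaf")
    case False
    have "dup_cong TYPE('k) (Node (rep l) Succ (Node Leaf Prec (rep (under r y))))
        (Node (rep l) Succ (Node ?s Prec (rep y)))"
      by (intro tree_cong_Node s) simp
    \<comment> \<open>This is the mixed relation (x \<succ> y) \<prec> z = x \<succ> (y \<prec> z),
      read from right to left.\<close>
    also have "dup_cong TYPE('k) \<dots> (Node (Node (rep l) Succ ?s) Prec (rep y))"
      by (rule tree_cong_sym, rule dup_cong_assoc) (simp add: dup_word_Cons)
    finally show ?thesis using False Node.prems by (simp add: Let_def)
  qed (use s Node.prems in \<open>simp add: Let_def\<close>)
qed simp

text \<open>Upper bound for Dup: the normal forms span every component of the quotient. With
  \<open>dup_ideal_ev_class\<close> they form a basis.\<close>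

lemma dup_cong_rep_ev: "dup_cong TYPE('k::field) t (rep (ev t))"
proof (induction t)
  case (Node l g r)
  have "dup_cong TYPE('k) (Node l g r) (Node (rep (ev l)) g (rep (ev r)))"
    by (rule tree_cong_Node) (rule Node)+
  also have "dup_cong TYPE('k) \<dots> (rep (ev (Node l g r)))"
    by (rule tree_cong_sym) (cases g; simp add: rep_over rep_under)
  finally show ?case .
qed simp

text \<open>Substitution for the \<open>i\<close>-th generator, which is the \<open>i\<close>-th node in inorder.\<close>

fun subst_node :: "unit tree \<Rightarrow> nat \<Rightarrow> unit tree \<Rightarrow> unit tree" where
  "subst_node Leaf i y = Leaf"
| "subst_node (Node l u r) i y =
     (if i < size l then Node (subst_node l i y) u r
      else if i = size l then over l (under y r)
      else Node l u (subst_node r (i - size l - 1) y))"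

lemma subst_node_ge: "size x \<le> i \<Longrightarrow> subst_node x i y = x"
  by (induction x arbitrary: i) auto

lemma subst_node_over:
  "y \<noteq> Leaf \<Longrightarrow> subst_node (over x z) i y =
    (if i < size x then over (subst_node x i y) z else over x (subst_node z (i - size x) y))"
proof (induction z)
  case Leaf
  then show ?case by (simp add: subst_node_ge)
next
  case (Node l u r)
  then show ?case by (auto simp: over_assoc)
qed

lemma subst_node_under:
  "y \<noteq> Leaf \<Longrightarrow> subst_node (under x z) i y =
    (if i < size x then under (subst_node x i y) z else under x (subst_node z (i - size x) y))"
proof (induction x arbitrary: i)
  case (Node l u r)
  then show ?case by (auto simp: over_under under_assoc)
qed simp

lemma subst_node_dup_mult:
  "y \<noteq> Leaf \<Longrightarrow> subst_node (dup_mult g x z) i y =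
    (if i < size x then dup_mult g (subst_node x i y) z else dup_mult g x (subst_node z (i - size x) y))"
  by (cases g) (simp_all add: subst_node_over subst_node_under)

lemma ev_graft: "i < size1 t \<Longrightarrow> ev (graft t i s) = subst_node (ev t) i (ev s)"
  by (induction t arbitrary: i) (auto simp: subst_node_dup_mult)

definition ev_class :: "dup_op tree \<Rightarrow> (unit tree \<Rightarrow>\<^sub>0 'k::field)" where
  "ev_class t = Poly_Mapping.single (ev t) 1"

text \<open>Both sides of each relation have the same value, and by \<open>ev_graft\<close> the
  value of a graft is determined by the values of its factors, so \<open>ev\<close> descends to the
  quotient operad.\<close>

lemma dup_ideal_ev_class:
  assumes "in_ideal dup_relators n (f :: _ \<Rightarrow>\<^sub>0 'k::field)"
  shows "lin_ext ev_class f = (0 :: _ \<Rightarrow>\<^sub>0 'k)"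
  using assms
proof (rule in_ideal_lin_ext_zero)
  fix r :: "dup_op tree \<Rightarrow>\<^sub>0 'k" assume "r \<in> dup_relators"
  then show "lin_ext ev_class r = (0 :: _ \<Rightarrow>\<^sub>0 'k)"
    by (auto simp: dup_relators_def assoc_relator_def ev_class_def lin_ext_linear)
next
  fix i :: nat and s
  have "ev_class (graft t i s) = lin_ext (\<lambda>x. Poly_Mapping.single (subst_node x i (ev s)) 1) (ev_class t :: _ \<Rightarrow>\<^sub>0 'k)"
    if "i < size1 t" for t
    using that by (simp add: ev_class_def ev_graft)
  then show "\<exists>G. \<forall>t. i < size1 t \<longrightarrow> ev_class (graft t i s) = lin_ext G (ev_class t :: _ \<Rightarrow>\<^sub>0 'k)"
    by blast
next
  fix i :: nat and t :: "dup_op tree" assume i: "i < size1 t"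
  have "ev_class (graft t i s) = lin_ext (\<lambda>y. Poly_Mapping.single (subst_node (ev t) i y) 1) (ev_class s :: _ \<Rightarrow>\<^sub>0 'k)" for s
    using i by (simp add: ev_class_def ev_graft)
  then show "\<exists>G. \<forall>s. ev_class (graft t i s) = lin_ext G (ev_class s :: _ \<Rightarrow>\<^sub>0 'k)"
    by blast
qed


subsection \<open>The Koszul complex on normal forms and its contraction\<close>

definition cons_fun :: "'g \<Rightarrow> 'a \<Rightarrow> 'g list \<times> 'a list \<Rightarrow> ('g list \<times> 'a list \<Rightarrow>\<^sub>0 'k::field)" where
  "cons_fun c y = (\<lambda>(w, ys). Poly_Mapping.single (c # w, y # ys) 1)"

text \<open>The recursion separates the product of the first two factors; prepending a factor shifts
  the other positions by one, hence the minus sign. This form suits a homotopy acting on the first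
  factor only.\<close>

fun nf_diff :: "dup_op list \<times> unit tree list \<Rightarrow> (dup_op list \<times> unit tree list \<Rightarrow>\<^sub>0 'k::field)" where
  "nf_diff (c # w, y # z # ys) =
     Poly_Mapping.single (w, dup_mult c y z # ys) 1 - lin_ext (cons_fun c y) (nf_diff (w, z # ys))"
| "nf_diff _ = 0"

text \<open>Splits \<open>y = v \<succ> y'\<close> with \<open>v\<close> indecomposable for \<open>\<succ>\<close>, that is, with empty left subtree.\<close>

primrec split_over :: "unit tree \<Rightarrow> (unit tree \<times> unit tree) option" where
  "split_over Leaf = None"
| "split_over (Node l u r) =
     (case split_over l of
        None \<Rightarrow> if l = Leaf then None else Some (l, Node Leaf u r)
      | Some (v, l') \<Rightarrow> Some (v, Node l' u r))"

text \<open>A \<open>\<prec>\<close>-splitting is used only if \<open>w\<close> contains no \<open>\<succ>\<close>, which for the words \<open>\<succ>\<^sup>a \<prec>\<^sup>b\<close> can be seen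
  from the first letter.\<close>

definition split_first :: "dup_op list \<Rightarrow> unit tree \<Rightarrow> (dup_op \<times> unit tree \<times> unit tree) option" where
  "split_first w y = (if y = Leaf then None else case split_over y of
      Some (v, y') \<Rightarrow> Some (Succ, v, y')
    | None \<Rightarrow> if right y = Leaf \<or> (w \<noteq> [] \<and> hd w = Succ) then None
        else Some (Prec, Node Leaf () Leaf, right y))"

fun nf_homotopy :: "dup_op list \<times> unit tree list \<Rightarrow> (dup_op list \<times> unit tree list \<Rightarrow>\<^sub>0 'k::field)" where
  "nf_homotopy (w, y # ys) =
     (case split_first w y of
        Some (g, u, v) \<Rightarrow> Poly_Mapping.single (g # w, u # v # ys) 1
      | None \<Rightarrow> 0)"
| "nf_homotopy (w, []) = 0"

section \<open>Compatibility of the splittings with the products\<close>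

lemma split_over_SomeD:
  "split_over y = Some (v, y') \<Longrightarrow> over v y' = y \<and> v \<noteq> Leaf \<and> y' \<noteq> Leaf"
  by (induction y arbitrary: v y') (auto split: option.splits if_splits)

lemma split_over_over_Some:
  "split_over y = Some (v, y') \<Longrightarrow> split_over (over y z) = Some (v, over y' z)"
  by (induction z) auto

lemma split_over_over_None:
  "split_over y = None \<Longrightarrow> y \<noteq> Leaf \<Longrightarrow> z \<noteq> Leaf \<Longrightarrow> split_over (over y z) = Some (y, z)"
proof (induction z)
  case (Node l u r)
  then show ?case by (cases "l = Leaf") auto
qed simp

text \<open>For nonempty \<open>y\<close>, \<open>under y z\<close> alters only the right subtree of
  the root, while the split-off factor is read from the left subtree.\<close>

lemma split_over_under_Some:
  "split_over y = Some (v, y') \<Longrightarrow> split_over (under y z) = Some (v, under y' z)"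
  by (cases y) (auto split: option.splits if_splits)

lemma split_over_under_None:
  "split_over y = None \<Longrightarrow> y \<noteq> Leaf \<Longrightarrow> split_over (under y z) = None"
  by (cases y) (auto split: option.splits if_splits)

lemma split_over_NoneD:
  "split_over y = None \<Longrightarrow> y \<noteq> Leaf \<Longrightarrow> \<exists>r. y = Node Leaf () r"
  by (cases y) (auto split: option.splits if_splits)

lemma split_first_SomeD:
  assumes "split_first w y = Some (g, u, v)"
  shows "dup_mult g u v = y \<and> u \<noteq> Leaf \<and> v \<noteq> Leaf"
proof -
  have y: "y \<noteq> Leaf" using assms by (auto simp: split_first_def)
  show ?thesis
  proof (cases "split_over y")
    case None
    then show ?thesis using assms y split_over_NoneD[OF None y]
      by (auto simp: split_first_def split: if_splits)
  next
    case (Some p)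
    then show ?thesis using assms y split_over_SomeD[of y]
      by (cases p) (auto simp: split_first_def)
  qed
qed

lemma hd_not_Succ: "dup_word w \<Longrightarrow> \<not> (w \<noteq> [] \<and> hd w = Succ) \<Longrightarrow> set w \<subseteq> {Prec}"
  by (cases w; cases "hd w") (auto simp: dup_word_Cons)

lemma split_first_dup_word:
  assumes "split_first w y = Some (g, u, v)" "dup_word w"
  shows "dup_word (g # w)"
proof -
  have y: "y \<noteq> Leaf" using assms by (auto simp: split_first_def)
  then show ?thesis using assms hd_not_Succ[of w]
    by (auto simp: split_first_def dup_word_Cons split: option.splits if_splits)
qed

text \<open>Of the word only the first letter is inspected, so products formed further to the right
  do not change the splitting.\<close>

lemma split_first_Cons: "split_first (c # w) y = split_first (c # w') y"
  by (simp add: split_first_def)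

text \<open>If the first factor splits, multiplying it by the next one affects only the second part,
  by associativity. A \<open>Prec\<close> splitting occurs only for \<open>c = Prec\<close>; then
  \<open>w\<close> consists of \<open>Prec\<close> and the test on its first letter is
  passed.\<close>

lemma split_first_mult_Some:
  assumes "split_first (c # w) y = Some (g, u, v)" "dup_word (c # w)" "z \<noteq> Leaf"
  shows "split_first w (dup_mult c y z) = Some (g, u, dup_mult c v z)"
proof -
  have y: "y \<noteq> Leaf" using assms by (auto simp: split_first_def)
  show ?thesis
  proof (cases "split_over y")
    case None
    then have c: "c = Prec" "right y \<noteq> Leaf"
      and guv: "g = Prec" "u = Node Leaf () Leaf" "v = right y"
      using assms y by (cases c; auto simp: split_first_def split: if_splits)+
    have w: "\<not> (w \<noteq> [] \<and> hd w = Succ)" using assms(2) c by (cases w) (auto simp: dup_word_Cons)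
    have "right (under y z) = under (right y) z" using y by (cases y) auto
    with w c guv y split_over_under_None[OF None y, of z] show ?thesis
      by (auto simp: split_first_def)
  next
    case (Some p)
    then show ?thesis using assms y
      by (cases p; cases c) (auto simp: split_first_def split_over_over_Some split_over_under_Some)
  qed
qed

text \<open>A factor that does not split is recovered from its product with the next one: for
  \<open>Succ\<close> it is \<succ>-indecomposable, for \<open>Prec\<close> it is the
  generator.\<close>

lemma split_first_mult_None:
  assumes "split_first (c # w) y = None" "dup_word (c # w)" "y \<noteq> Leaf" "z \<noteq> Leaf"
  shows "split_first w (dup_mult c y z) = Some (c, y, z)"
proof -
  have n: "split_over y = None"
    using assms by (auto simp: split_first_def split: option.splits)
  show ?thesis
  proof (cases c)
    case Succ
    then show ?thesis using assms n by (simp add: split_first_def split_over_over_None)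
  next
    case Prec
    then have "right y = Leaf" using assms n by (auto simp: split_first_def split: if_splits)
    then have y: "y = Node Leaf () Leaf" using split_over_NoneD[OF n assms(3)] by auto
    have w: "\<not> (w \<noteq> [] \<and> hd w = Succ)" using assms(2) Prec by (cases w) (auto simp: dup_word_Cons)
    show ?thesis using Prec y w assms by (auto simp: split_first_def)
  qed
qed

text \<open>If the first factor splits, the first product undoes the splitting and all other terms
  cancel. If not, the homotopy vanishes on the element and on all terms of its differential except
  the first, which it turns back into the element. The last assumption excludes the generator alone,
  which carries the homology.\<close>

lemma nf_diff_homotopy:
  assumes "dup_word w" "length ys = Suc (length w)" "Leaf \<notin> set ys" "w \<noteq> [] \<or> hd ys \<noteq> Node Leaf () Leaf"
  shows "lin_ext nf_diff (nf_homotopy (w, ys)) + lin_ext nf_homotopy (nf_diff (w, ys))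
    = (Poly_Mapping.single (w, ys) 1 :: _ \<Rightarrow>\<^sub>0 'k::field)"
proof -
  from assms obtain y zs where ys: "ys = y # zs" "y \<noteq> Leaf" "length zs = length w" "Leaf \<notin> set zs"
    by (cases ys) auto
  show ?thesis
  proof (cases "split_first w y")
    case (Some p)
    then obtain g u v where split: "split_first w y = Some (g, u, v)" by (cases p) auto
    \<comment> \<open>This cancels the tail of the differential of
      \<open>(g # w, u # v # zs)\<close>, where the same sum has a minus sign.\<close>
    have "lin_ext nf_homotopy (nf_diff (w, y # zs))
        = lin_ext (cons_fun g u) (nf_diff (w, v # zs) :: _ \<Rightarrow>\<^sub>0 'k)"
    proof (cases w)
      case (Cons c w')
      then obtain z zs' where zs: "zs = z # zs'" "z \<noteq> Leaf" using ys by (cases zs) auto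
      have *: "split_first w' (dup_mult c y z) = Some (g, u, dup_mult c v z)"
        using split_first_mult_Some split Cons assms(1) zs by blast
      have "lin_ext nf_homotopy (cons_fun c y b) = lin_ext (cons_fun g u) (cons_fun c v b :: _ \<Rightarrow>\<^sub>0 'k)" for b
        using split_first_Cons[of c "fst b" y w'] split Cons
        by (cases b) (simp add: cons_fun_def)
      with Cons zs * show ?thesis
        by (simp add: lin_ext_linear lin_ext_lin_ext) (simp add: cons_fun_def)
    qed simp
    then show ?thesis
      using split ys split_first_SomeD[OF split] by simp
  next
    case None
    \<comment> \<open>With the empty word, a factor that does not split would be the
      generator.\<close>
    then obtain c w' where w: "w = c # w'"
      using assms ys split_over_NoneD[of y]
      by (cases w) (auto simp: split_first_def split: option.splits if_splits)
    then obtain z zs' where zs: "zs = z # zs'" "z \<noteq> Leaf" using ys by (cases zs) auto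
    have *: "split_first w' (dup_mult c y z) = Some (c, y, z)"
      using split_first_mult_None None w assms(1) ys(2) zs by blast
    have "lin_ext nf_homotopy (cons_fun c y b :: _ \<Rightarrow>\<^sub>0 'k) = (0 :: _ \<Rightarrow>\<^sub>0 'k)" for b
      using split_first_Cons[of c "fst b" y w'] None w by (cases b) (simp add: cons_fun_def)
    with None ys w zs * show ?thesis
      by (simp add: lin_ext_linear lin_ext_lin_ext)
  qed
qed

section \<open>The square of the differential on normal forms\<close>

lemma keys_lin_ext_cons_fun:
  "Poly_Mapping.keys (lin_ext (cons_fun c y) m :: _ \<Rightarrow>\<^sub>0 'k::field) \<subseteq> {b. snd b \<noteq> []}"
proof -
  have "Poly_Mapping.keys (cons_fun c y b :: _ \<Rightarrow>\<^sub>0 'k) \<subseteq> {b. snd b \<noteq> []}" for b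
    by (cases b) (simp add: cons_fun_def)
  then show ?thesis
    by (intro order_trans[OF keys_lin_ext] UN_least)
qed

lemma nf_diff_keys:
  assumes "(w, ys) \<in> Poly_Mapping.keys (nf_diff p :: _ \<Rightarrow>\<^sub>0 'k::field)"
  shows "ys \<noteq> []"
proof (cases p rule: nf_diff.cases)
  case (1 c u y z zs)
  have "Poly_Mapping.keys (nf_diff p :: _ \<Rightarrow>\<^sub>0 'k)
    \<subseteq> Poly_Mapping.keys (Poly_Mapping.single (u, dup_mult c y z # zs) (1::'k))
      \<union> Poly_Mapping.keys (lin_ext (cons_fun c y) (nf_diff (u, z # zs)) :: _ \<Rightarrow>\<^sub>0 'k)"
    unfolding 1 nf_diff.simps by (rule keys_diff)
  also have "\<dots> \<subseteq> {b. snd b \<noteq> []}"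
    by (rule Un_least[OF _ keys_lin_ext_cons_fun]) simp
  finally show ?thesis using assms by auto
qed (use assms in simp_all)

lemma nf_diff_cons_fun:
  assumes "\<And>w ys. (w, ys) \<in> Poly_Mapping.keys m \<Longrightarrow> ys \<noteq> []"
  shows "lin_ext nf_diff (lin_ext (cons_fun c y) m)
    = lin_ext (\<lambda>(w, ys). Poly_Mapping.single (w, dup_mult c y (hd ys) # tl ys) 1) m
      - lin_ext (cons_fun c y) (lin_ext nf_diff m :: _ \<Rightarrow>\<^sub>0 'k::field)"
proof -
  have "lin_ext nf_diff (cons_fun c y b :: _ \<Rightarrow>\<^sub>0 'k)
      = (case b of (w, ys) \<Rightarrow> Poly_Mapping.single (w, dup_mult c y (hd ys) # tl ys) 1)
        - lin_ext (cons_fun c y) (nf_diff b :: _ \<Rightarrow>\<^sub>0 'k)"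
    if "b \<in> Poly_Mapping.keys m" for b
  proof -
    obtain w ys where b: "b = (w, ys)" by fastforce
    with assms that have "ys \<noteq> []" by blast
    then obtain z zs where "ys = z # zs" by (cases ys) auto
    with b show ?thesis by (simp add: cons_fun_def)
  qed
  then show ?thesis
    by (simp add: lin_ext_lin_ext lin_ext_fun_diff[symmetric] cong: lin_ext_cong)
qed

text \<open>Products at distant places cancel by sign; those at adjacent places cancel by
  \<open>dup_mult_assoc\<close>, which applies because two adjacent letters of an admissible word
  are admissible.\<close>

lemma nf_diff_nf_diff:
  "dup_word w \<Longrightarrow> length ys = Suc (length w) \<Longrightarrow> Leaf \<notin> set ys \<Longrightarrow>
    lin_ext nf_diff (nf_diff (w, ys)) = (0 :: _ \<Rightarrow>\<^sub>0 'k::field)"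
proof (induction w arbitrary: ys)
  case (Cons c w)
  then obtain y z zs where ys: "ys = y # z # zs" "y \<noteq> Leaf" "z \<noteq> Leaf" "Leaf \<notin> set zs" "length zs = length w"
    by (cases ys; cases "tl ys") auto
  have w: "dup_word w" using Cons.prems by (simp add: dup_word_Cons)
  let ?mul = "(\<lambda>(w, ys). Poly_Mapping.single (w, dup_mult c y (hd ys) # tl ys) 1) :: _ \<Rightarrow> (_ \<Rightarrow>\<^sub>0 'k)"
  have "lin_ext nf_diff (lin_ext (cons_fun c y) (nf_diff (w, z # zs)))
      = lin_ext ?mul (nf_diff (w, z # zs))
        - lin_ext (cons_fun c y) (lin_ext nf_diff (nf_diff (w, z # zs)))"
    by (rule nf_diff_cons_fun) (rule nf_diff_keys)
  also have "\<dots> = lin_ext ?mul (nf_diff (w, z # zs))"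
    using Cons.IH[OF w, of "z # zs"] ys by simp
  \<comment> \<open>In the first term of \<open>nf_diff (w, z # zs)\<close> this is associativity;
    in the others \<open>z\<close> is just carried along.\<close>
  also have "\<dots> = nf_diff (w, dup_mult c y z # zs)"
  proof (cases w)
    case (Cons c' w')
    then obtain x xs where zs: "zs = x # xs" using ys by (cases zs) auto
    have "dup_word [c, c']" using Cons.prems Cons by (auto simp: dup_word_Cons)
    then have "dup_mult c' (dup_mult c y z) x = dup_mult c y (dup_mult c' z x)"
      using dup_mult_assoc ys by blast
    moreover have "lin_ext ?mul (cons_fun c' z b) = cons_fun c' (dup_mult c y z) b" for b
      by (cases b) (simp add: cons_fun_def)
    ultimately show ?thesis
      using Cons zs by (simp add: lin_ext_linear lin_ext_lin_ext)
  qed simp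
  finally show ?case using ys by (simp add: lin_ext_linear)
qed simp


subsection \<open>Comparison of the two complexes\<close>

definition merge :: "('a \<Rightarrow> 'a \<Rightarrow> 'a) \<Rightarrow> nat \<Rightarrow> 'a list \<Rightarrow> 'a list" where
  "merge f i xs = take i xs @ [f (xs ! i) (xs ! Suc i)] @ drop (i + 2) xs"

definition remove_at :: "nat \<Rightarrow> 'a list \<Rightarrow> 'a list" where
  "remove_at i w = take i w @ drop (Suc i) w"

lemma length_remove_at: "i < length w \<Longrightarrow> Suc (length (remove_at i w)) = length w"
  by (simp add: remove_at_def)

lemma length_merge: "Suc i < length xs \<Longrightarrow> Suc (length (merge f i xs)) = length xs"
  by (simp add: merge_def)

lemma map_merge:
  assumes "\<And>x y. h (f x y) = f' (h x) (h y)" "Suc i < length xs"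
  shows "map h (merge f i xs) = merge f' i (map h xs)"
  using assms(2) by (simp add: merge_def assms(1) take_map drop_map)

lemma sum_list_merge:
  fixes h :: "'a \<Rightarrow> nat"
  assumes "\<And>x y. h (f x y) = h x + h y" "Suc i < length xs"
  shows "sum_list (map h (merge f i xs)) = sum_list (map h xs)"
proof -
  have "xs = take i xs @ [xs ! i, xs ! Suc i] @ drop (i + 2) xs"
    using assms(2) by (simp add: Cons_nth_drop_Suc)
  then have "sum_list (map h xs) = sum_list (map h (take i xs @ [xs ! i, xs ! Suc i] @ drop (i + 2) xs))"
    by simp
  then show ?thesis by (simp add: merge_def assms(1))
qed

lemma dup_word_remove_at: "dup_word w \<Longrightarrow> i < length w \<Longrightarrow> dup_word (remove_at i w)"
  using dup_word_insertD[of "take i w" "[w ! i]" "drop (Suc i) w"]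
  by (simp add: remove_at_def id_take_nth_drop[symmetric])

lemma smult_single: "smult c (Poly_Mapping.single b d) = Poly_Mapping.single b (c * d)"
  by (rule poly_mapping_eqI) (simp add: lookup_smult lookup_single when_def)

lemma nf_diff_sum:
  "length ys = Suc (length w) \<Longrightarrow>
    nf_diff (w, ys) = (\<Sum>i<length w.
      Poly_Mapping.single (remove_at i w, merge (dup_mult (w ! i)) i ys) ((- 1 :: 'k::field) ^ i))"
proof (induction w arbitrary: ys)
  case (Cons c w)
  then obtain y z zs where ys: "ys = y # z # zs" "length zs = length w"
    by (cases ys; cases "tl ys") auto
  then have IH: "nf_diff (w, z # zs) = (\<Sum>i<length w.
      Poly_Mapping.single (remove_at i w, merge (dup_mult (w ! i)) i (z # zs)) ((- 1 :: 'k) ^ i))"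
    by (intro Cons.IH) simp
  show ?case
    unfolding ys nf_diff.simps IH length_Cons sum.lessThan_Suc_shift
    by (simp add: lin_ext_sum lin_ext_single cons_fun_def smult_single single_uminus sum_negf
        remove_at_def merge_def)
qed simp

lemma tensor_trees_word_sum:
  "tensor_trees (word_sum w) ts = (\<Sum>t | inorder t = w. Poly_Mapping.single (t, ts) 1)"
  by (simp add: tensor_trees_def word_sum_def lin_ext_sum)

text \<open>Splitting off a generator at leaf \<open>i\<close> deletes letter \<open>i\<close> of
  the inorder word. Conversely every tree with the shortened word arises exactly once, by grafting
  the node labelled \<open>w ! i\<close> at leaf \<open>i\<close>.\<close>

lemma koszul_diff_word_sum:
  "koszul_diff (tensor_trees (word_sum w) ts) = (\<Sum>i<length w. smult ((- 1 :: 'k::field) ^ i)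
      (tensor_trees (word_sum (remove_at i w)) (merge (\<lambda>l r. Node l (w ! i) r) i ts)))"
proof -
  let ?S = "Sigma {t. inorder t = w} splits"
  let ?T = "Sigma {..<length w} (\<lambda>i. {t. inorder t = remove_at i w})"
  let ?f = "\<lambda>i g t'. Poly_Mapping.single (t', merge (\<lambda>l r. Node l g r) i ts) ((- 1 :: 'k) ^ i)"
  have splitsD: "graft t' i (Node Leaf g Leaf) = t \<and> i < length w \<and> w ! i = g \<and> inorder t' = remove_at i w"
    if "(i, g, t') \<in> splits t" "inorder t = w" for i g t' t
  proof -
    have i: "i < size1 t'" "graft t' i (Node Leaf g Leaf) = t"
      using that by (auto simp: splits_def)
    then have "w = take i (inorder t') @ g # drop i (inorder t')"
      using that(2) inorder_graft[OF i(1), of "Node Leaf g Leaf"] by simp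
    with i show ?thesis
      by (simp add: remove_at_def nth_append size1_size)
  qed
  have graftI: "(i, w ! i, t') \<in> splits (graft t' i (Node Leaf (w ! i) Leaf)) \<and> inorder (graft t' i (Node Leaf (w ! i) Leaf)) = w"
    if "i < length w" "inorder t' = remove_at i w" for i t'
  proof -
    have "i < size1 t'"
      using that length_remove_at[of i w] by (simp add: size1_eq_length_inorder del: length_inorder)
    then show ?thesis
      using that by (simp add: splits_def inorder_graft remove_at_def id_take_nth_drop[symmetric])
  qed
  have "koszul_diff (tensor_trees (word_sum w) ts)
      = (\<Sum>t | inorder t = w. \<Sum>p\<in>splits t. case p of (i, g, t') \<Rightarrow> ?f i g t')"
    by (simp add: tensor_trees_word_sum koszul_diff_def lin_ext_sum koszul_diff_basis_def merge_def)
  also have "\<dots> = (\<Sum>(t, i, g, t')\<in>?S. ?f i g t')"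
    by (subst sum.Sigma) (auto simp: finite_inorder_eq finite_splits)
  also have "\<dots> = (\<Sum>(i, t')\<in>?T. ?f i (w ! i) t')"
    by (rule sum.reindex_bij_witness[of _ "\<lambda>(i, t'). (graft t' i (Node Leaf (w ! i) Leaf), i, w ! i, t')"
          "\<lambda>(t, i, g, t'). (i, t')"])
      (auto dest: splitsD graftI)
  also have "\<dots> = (\<Sum>i<length w. \<Sum>t' | inorder t' = remove_at i w. ?f i (w ! i) t')"
    by (subst sum.Sigma) (auto simp: finite_inorder_eq)
  finally show ?thesis
    by (simp add: tensor_trees_word_sum fs.scale_sum_right smult_single)
qed

text \<open>All trees with inorder \<open>w\<close> have the same coefficient in \<^const>\<open>word_sum\<close> \<open>w\<close>, so reading off
  the right comb is enough.\<close>

definition to_nf :: "dup_op tree \<times> dup_op tree list \<Rightarrow> (dup_op list \<times> unit tree list \<Rightarrow>\<^sub>0 'k::field)" where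
  "to_nf = (\<lambda>(t, ts). if t = comb (inorder t)
     then Poly_Mapping.single (inorder t, map ev ts) 1 else 0)"

text \<open>On the spans used below, \<open>to_nf\<close> after \<open>of_nf\<close> is the
  identity, and the other composite is the identity modulo \<open>koszul_den\<close>.\<close>

definition of_nf :: "dup_op list \<times> unit tree list \<Rightarrow> (dup_op tree \<times> dup_op tree list \<Rightarrow>\<^sub>0 'k::field)" where
  "of_nf = (\<lambda>(w, ys). tensor_trees (word_sum w) (map rep ys))"

lemma to_nf_word_sum:
  "lin_ext to_nf (tensor_trees (word_sum w) ts) = Poly_Mapping.single (w, map ev ts) 1"
proof -
  have "lin_ext to_nf (tensor_trees (word_sum w) ts)
      = (\<Sum>t | inorder t = w. if t = comb w then Poly_Mapping.single (w, map ev ts) 1 else 0)"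
    by (simp add: tensor_trees_word_sum lin_ext_sum to_nf_def) (rule sum.cong; auto)
  then show ?thesis by (simp add: finite_inorder_eq)
qed

definition koszul_gens :: "nat \<Rightarrow> nat \<Rightarrow> (dup_op tree \<times> dup_op tree list \<Rightarrow>\<^sub>0 'k::field) set" where
  "koszul_gens k n = {tensor_trees (word_sum w) ts | w ts.
     dup_word w \<and> Suc (length w) = k \<and> length ts = k \<and> sum_list (map size1 ts) = n}"

definition nf_gens :: "nat \<Rightarrow> nat \<Rightarrow> (dup_op list \<times> unit tree list \<Rightarrow>\<^sub>0 'k::field) set" where
  "nf_gens k n = {Poly_Mapping.single (w, ys) 1 | w ys.
     dup_word w \<and> Suc (length w) = k \<and> length ys = k \<and> Leaf \<notin> set ys \<and> sum_list (map size ys) = n}"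

abbreviation dup_num :: "nat \<Rightarrow> nat \<Rightarrow> (dup_op tree \<times> dup_op tree list \<Rightarrow>\<^sub>0 'k::field) set" where
  "dup_num \<equiv> koszul_num dup_relators"

abbreviation dup_den :: "nat \<Rightarrow> nat \<Rightarrow> (dup_op tree \<times> dup_op tree list \<Rightarrow>\<^sub>0 'k::field) set" where
  "dup_den \<equiv> koszul_den dup_relators"

section \<open>Numerators, denominators and differential under the comparison maps\<close>

lemma koszul_num_eq:
  "(dup_num k n :: (_ \<Rightarrow>\<^sub>0 'k::field) set) = fs.span (koszul_gens k n)"
proof
  show "fs.span (koszul_gens k n) \<subseteq> (dup_num k n :: (_ \<Rightarrow>\<^sub>0 'k) set)"
    unfolding koszul_num_def koszul_gens_def
    using word_sum_in_dual by (intro fs.span_mono) blast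
next
  have "tensor_trees x ts \<in> fs.span (koszul_gens k n)"
    if x: "x \<in> koszul_dual_lin (dup_relators :: (_ \<Rightarrow>\<^sub>0 'k) set) k"
      and ts: "length ts = k" "sum_list (map size1 ts) = n" for x ts
    unfolding tensor_trees_def
  proof (rule lin_ext_in_span[OF koszul_dual_lin_subset[OF x]], goal_cases)
    case (1 s)
    then show ?case
      using ts by (intro fs.span_base) (auto simp: koszul_gens_def tensor_trees_def)
  qed
  then show "(dup_num k n :: (_ \<Rightarrow>\<^sub>0 'k) set) \<subseteq> fs.span (koszul_gens k n)"
    unfolding koszul_num_def by (intro fs.span_minimal) auto
qed

lemma koszul_den_subset: "(dup_den k n :: (_ \<Rightarrow>\<^sub>0 'k::field) set) \<subseteq> dup_num k n"
  unfolding koszul_den_def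
proof (rule fs.span_minimal)
  show "fs.subspace (dup_num k n :: (_ \<Rightarrow>\<^sub>0 'k::field) set)"
    by (simp add: koszul_num_def)
next
  have "tensor_at x ts j f \<in> dup_num k n"
    if x: "x \<in> koszul_dual_lin (dup_relators :: (_ \<Rightarrow>\<^sub>0 'k) set) k"
      and ts: "length ts = k" "sum_list (map size1 ts) = n" "j < k"
      and f: "in_ideal dup_relators (size1 (ts ! j)) f" for x ts j f
    unfolding tensor_at_def lin_ext_def
  proof (intro fs.span_sum fs.span_scale fs.span_base koszul_num_def[THEN equalityD2, THEN subsetD])
    fix s assume "s \<in> Poly_Mapping.keys f"
    then have "size1 s = size1 (ts ! j)" using in_ideal_free_op[OF f] by (auto simp: free_op_def)
    then have "map size1 (ts[j := s]) = map size1 ts"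
      using ts by (metis list_update_id map_update)
    then show "tensor_trees x (ts[j := s]) \<in> {tensor_trees x ts | x ts.
        x \<in> koszul_dual_lin dup_relators k \<and> length ts = k \<and> sum_list (map size1 ts) = n}"
      using x ts by (intro CollectI exI[of _ x] exI[of _ "ts[j := s]"]) simp
  qed
  then show "{tensor_at x ts j f | x ts j f.
      x \<in> koszul_dual_lin (dup_relators :: (_ \<Rightarrow>\<^sub>0 'k) set) k \<and> length ts = k \<and>
      sum_list (map size1 ts) = n \<and> j < k \<and> in_ideal dup_relators (size1 (ts ! j)) f} \<subseteq> dup_num k n"
    by blast
qed

text \<open>The truncated \<open>k - 1\<close> is harmless at \<open>k = 0\<close>, where there are
  no generators.\<close>

lemma koszul_diff_in_num:
  assumes "z \<in> dup_num k n"
  shows "koszul_diff z \<in> (dup_num (k - 1) n :: (_ \<Rightarrow>\<^sub>0 'k::field) set)"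
  unfolding koszul_num_eq koszul_diff_def
proof (rule lin_ext_in_span[OF assms[unfolded koszul_num_eq]])
  fix s :: "_ \<Rightarrow>\<^sub>0 'k" assume "s \<in> koszul_gens k n"
  then obtain w ts where s: "s = tensor_trees (word_sum w) ts" "dup_word w" "Suc (length w) = k"
    "length ts = k" "sum_list (map size1 ts) = n"
    by (auto simp: koszul_gens_def)
  have "tensor_trees (word_sum (remove_at i w)) (merge (\<lambda>l r. Node l (w ! i) r) i ts)
      \<in> koszul_gens (k - 1) n" if "i < length w" for i
    unfolding koszul_gens_def
    using s that length_remove_at[OF that] length_merge[of i ts "\<lambda>l r. Node l (w ! i) r"]
      sum_list_merge[of size1 "\<lambda>l r. Node l (w ! i) r" i ts] dup_word_remove_at[of w i]
    by (intro CollectI exI[of _ "remove_at i w"] exI[of _ "merge (\<lambda>l r. Node l (w ! i) r) i ts"]) auto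
  then have "koszul_diff s \<in> fs.span (koszul_gens (k - 1) n)"
    unfolding s koszul_diff_word_sum by (intro fs.span_sum fs.span_scale fs.span_base) auto
  then show "lin_ext koszul_diff_basis s \<in> fs.span (koszul_gens (k - 1) n)"
    by (simp add: koszul_diff_def)
qed

lemma to_nf_in_span:
  assumes "z \<in> dup_num k n"
  shows "lin_ext to_nf z \<in> fs.span (nf_gens k n :: (_ \<Rightarrow>\<^sub>0 'k::field) set)"
proof (rule lin_ext_in_span[OF assms[unfolded koszul_num_eq]])
  fix s :: "_ \<Rightarrow>\<^sub>0 'k" assume "s \<in> koszul_gens k n"
  then obtain w ts where s: "s = tensor_trees (word_sum w) ts" "dup_word w" "Suc (length w) = k"
    "length ts = k" "sum_list (map size1 ts) = n"
    by (auto simp: koszul_gens_def)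
  then have "lin_ext to_nf s \<in> nf_gens k n"
    unfolding nf_gens_def s(1) to_nf_word_sum
    by (intro CollectI exI[of _ w] exI[of _ "map ev ts"]) (auto simp: comp_def ev_not_Leaf[symmetric])
  then show "lin_ext to_nf s \<in> fs.span (nf_gens k n)" by (rule fs.span_base)
qed

lemma map_rep:
  assumes "Leaf \<notin> set ys"
  shows "map (ev \<circ> rep) ys = ys" "map (size1 \<circ> rep) ys = map size ys"
proof -
  have "ev (rep y) = y \<and> size1 (rep y) = size y" if "y \<in> set ys" for y
    using assms that ev_rep[of y] size1_rep[of y] by (cases "y = Leaf") auto
  then show "map (ev \<circ> rep) ys = ys" "map (size1 \<circ> rep) ys = map size ys"
    by (auto intro!: map_idI simp del: size1_size)
qed

lemma of_nf_in_num:
  assumes "m \<in> fs.span (nf_gens k n)"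
  shows "lin_ext of_nf m \<in> (dup_num k n :: (_ \<Rightarrow>\<^sub>0 'k::field) set)"
  unfolding koszul_num_eq
proof (rule lin_ext_in_span[OF assms])
  fix s :: "_ \<Rightarrow>\<^sub>0 'k" assume "s \<in> nf_gens k n"
  then obtain w ys where s: "s = Poly_Mapping.single (w, ys) 1" "dup_word w" "Suc (length w) = k"
    "length ys = k" "Leaf \<notin> set ys" "sum_list (map size ys) = n"
    by (auto simp: nf_gens_def)
  then have "lin_ext of_nf s \<in> koszul_gens k n"
    unfolding koszul_gens_def
    by (intro CollectI exI[of _ w] exI[of _ "map rep ys"]) (auto simp: of_nf_def map_rep)
  then show "lin_ext of_nf s \<in> fs.span (koszul_gens k n)" by (rule fs.span_base)
qed

lemma to_nf_of_nf:
  assumes "m \<in> fs.span (nf_gens k n)"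
  shows "lin_ext to_nf (lin_ext of_nf m) = (m :: _ \<Rightarrow>\<^sub>0 'k::field)"
proof -
  have "lin_ext (\<lambda>b. lin_ext to_nf (of_nf b :: _ \<Rightarrow>\<^sub>0 'k)) m = lin_ext (\<lambda>b. Poly_Mapping.single b 1) m"
    using assms by (rule lin_ext_eq_on_span) (auto simp: nf_gens_def of_nf_def to_nf_word_sum map_rep)
  then show ?thesis by (simp add: lin_ext_lin_ext lin_ext_id)
qed

text \<open>Membership in the numerator matters: \<open>to_nf\<close> sees combs only, while the
  differential of another tree may contain combs. On the generators the two alternating sums agree
  term by term.\<close>

lemma to_nf_diff:
  assumes "z \<in> dup_num k n"
  shows "lin_ext to_nf (koszul_diff z) = lin_ext nf_diff (lin_ext to_nf z :: _ \<Rightarrow>\<^sub>0 'k::field)"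
proof -
  have "lin_ext (\<lambda>b. lin_ext to_nf (koszul_diff_basis b :: _ \<Rightarrow>\<^sub>0 'k)) z
      = lin_ext (\<lambda>b. lin_ext nf_diff (to_nf b :: _ \<Rightarrow>\<^sub>0 'k)) z"
  proof (rule lin_ext_eq_on_span[OF assms[unfolded koszul_num_eq]])
    fix s :: "_ \<Rightarrow>\<^sub>0 'k" assume "s \<in> koszul_gens k n"
    then obtain w ts where s: "s = tensor_trees (word_sum w) ts" "length ts = Suc (length w)"
      by (auto simp: koszul_gens_def)
    have "lin_ext to_nf (koszul_diff s) = (\<Sum>i<length w. Poly_Mapping.single
        (remove_at i w, map ev (merge (\<lambda>l r. Node l (w ! i) r) i ts)) ((- 1 :: 'k) ^ i))"
      by (simp add: s(1) koszul_diff_word_sum lin_ext_linear to_nf_word_sum smult_single)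
    also have "\<dots> = (\<Sum>i<length w. Poly_Mapping.single
        (remove_at i w, merge (dup_mult (w ! i)) i (map ev ts)) ((- 1 :: 'k) ^ i))"
      using s by (intro sum.cong refl arg_cong2[where f = Poly_Mapping.single] arg_cong2[where f = Pair] map_merge) auto
    also have "\<dots> = nf_diff (w, map ev ts)"
      using s by (simp add: nf_diff_sum)
    also have "\<dots> = lin_ext nf_diff (lin_ext to_nf s)"
      by (simp add: s(1) to_nf_word_sum)
    finally show "lin_ext (\<lambda>b. lin_ext to_nf (koszul_diff_basis b)) s
        = lin_ext (\<lambda>b. lin_ext nf_diff (to_nf b)) s"
      by (simp add: koszul_diff_def lin_ext_lin_ext)
  qed
  then show ?thesis by (simp add: koszul_diff_def lin_ext_lin_ext)
qed

lemma to_nf_den: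
  assumes "z \<in> dup_den k n"
  shows "lin_ext to_nf z = (0 :: _ \<Rightarrow>\<^sub>0 'k::field)"
proof -
  have "lin_ext to_nf z = lin_ext (\<lambda>b. 0 :: _ \<Rightarrow>\<^sub>0 'k) z"
  proof (rule lin_ext_eq_on_span[OF assms[unfolded koszul_den_def]])
    fix u :: "_ \<Rightarrow>\<^sub>0 'k"
    assume "u \<in> {tensor_at x ts j f | x ts j f.
      x \<in> koszul_dual_lin dup_relators k \<and> length ts = k \<and> sum_list (map size1 ts) = n \<and>
      j < k \<and> in_ideal dup_relators (size1 (ts ! j)) f}"
    then obtain x ts j f where u: "u = tensor_at x ts j f"
      and f: "in_ideal dup_relators (size1 (ts ! j)) f"
      by blast
    \<comment> \<open>\<open>K\<close> is the comparison map with slot \<open>j\<close> left open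
      for an element of the free algebra, so \<open>to_nf\<close> of the tensor factors through
      \<open>ev_class\<close>, which kills the ideal.\<close>
    define K :: "unit tree \<Rightarrow> (dup_op list \<times> unit tree list \<Rightarrow>\<^sub>0 'k)" where
      "K y = lin_ext (\<lambda>t. if t = comb (inorder t)
        then Poly_Mapping.single (inorder t, (map ev ts)[j := y]) 1 else 0) x" for y
    have "lin_ext to_nf (tensor_trees x (ts[j := s])) = lin_ext K (ev_class s)" for s
      by (simp add: tensor_trees_def lin_ext_lin_ext to_nf_def map_update ev_class_def K_def cong: if_cong)
    then have "lin_ext to_nf u = lin_ext K (lin_ext ev_class f)"
      unfolding u tensor_at_def lin_ext_lin_ext by simp
    then show "lin_ext to_nf u = lin_ext (\<lambda>b. 0) u"
      using dup_ideal_ev_class[OF f] by simp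
  qed
  then show ?thesis by simp
qed

text \<open>The factors are replaced one at a time from the left; each replacement changes the
  tensor by an element with one factor in the ideal, and the differences telescope.\<close>

lemma tensor_trees_cong:
  assumes x: "x \<in> koszul_dual_lin (dup_relators :: (_ \<Rightarrow>\<^sub>0 'k::field) set) k"
    and ts: "length ts = k" "sum_list (map size1 ts) = n"
    and cong: "\<And>t. dup_cong TYPE('k) t (h t)"
  shows "tensor_trees x ts - tensor_trees x (map h ts) \<in> dup_den k n"
proof -
  have size: "size1 (h t) = size1 t" for t
    using cong[of t] by (simp add: tree_cong_def)
  have "m \<le> k \<Longrightarrow> tensor_trees x ts - tensor_trees x (map h (take m ts) @ drop m ts) \<in> dup_den k n" for m
  proof (induction m)
    case 0
    show ?case by (simp add: koszul_den_def fs.span_zero)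
  next
    case (Suc m)
    define us where "us = map h (take m ts) @ drop m ts"
    have m: "us ! m = ts ! m" "us[m := h (ts ! m)] = map h (take (Suc m) ts) @ drop (Suc m) ts" "length us = k"
      using Suc.prems ts
      by (auto simp: us_def nth_append list_update_append take_Suc_conv_app_nth
          Cons_nth_drop_Suc[symmetric])
    have "map size1 us = map size1 (take m ts @ drop m ts)"
      unfolding us_def map_append by (simp add: size del: append_take_drop_id)
    then have us: "sum_list (map size1 us) = n" using ts by simp
    have "tensor_at x us m (Poly_Mapping.single (ts ! m) 1 - Poly_Mapping.single (h (ts ! m)) 1) \<in> dup_den k n"
      unfolding koszul_den_def
      using cong[of "ts ! m"] Suc.prems m us x
      by (intro fs.span_base CollectI exI conjI) (auto simp: tree_cong_def)
    then have "tensor_trees x us - tensor_trees x (us[m := h (ts ! m)]) \<in> dup_den k n"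
      by (simp add: tensor_at_def lin_ext_linear m(1)[symmetric])
    moreover have "tensor_trees x ts - tensor_trees x us \<in> dup_den k n"
      unfolding us_def using Suc by simp
    ultimately have "(tensor_trees x ts - tensor_trees x us)
        + (tensor_trees x us - tensor_trees x (us[m := h (ts ! m)])) \<in> dup_den k n"
      unfolding koszul_den_def by (intro fs.span_add)
    then show ?case unfolding m(2) by simp
  qed
  from this[of k] ts show ?thesis by simp
qed

lemma of_nf_to_nf:
  assumes "z \<in> dup_num k n"
  shows "z - lin_ext of_nf (lin_ext to_nf z :: _ \<Rightarrow>\<^sub>0 'k::field) \<in> dup_den k n"
proof -
  let ?\<phi> = "\<lambda>b. Poly_Mapping.single b 1 - lin_ext of_nf (to_nf b :: _ \<Rightarrow>\<^sub>0 'k)"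
  have eq: "lin_ext ?\<phi> s = s - lin_ext of_nf (lin_ext to_nf s :: _ \<Rightarrow>\<^sub>0 'k)" for s
    by (simp add: lin_ext_fun_diff lin_ext_id lin_ext_lin_ext)
  have "lin_ext ?\<phi> z \<in> fs.span (dup_den k n)"
  proof (rule lin_ext_in_span[OF assms[unfolded koszul_num_eq]])
    fix s :: "_ \<Rightarrow>\<^sub>0 'k" assume "s \<in> koszul_gens k n"
    then obtain w ts where s: "s = tensor_trees (word_sum w) ts" "dup_word w" "Suc (length w) = k"
      "length ts = k" "sum_list (map size1 ts) = n"
      by (auto simp: koszul_gens_def)
    have "tensor_trees (word_sum w) ts - tensor_trees (word_sum w) (map (\<lambda>t. rep (ev t)) ts)
        \<in> (dup_den k n :: (_ \<Rightarrow>\<^sub>0 'k) set)"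
      using s word_sum_in_dual[of w] dup_cong_rep_ev by (intro tensor_trees_cong) auto
    then have "lin_ext ?\<phi> s \<in> dup_den k n"
      unfolding eq s(1) to_nf_word_sum by (simp add: of_nf_def comp_def)
    then show "lin_ext ?\<phi> s \<in> fs.span (dup_den k n)" by (rule fs.span_base)
  qed
  then show ?thesis unfolding eq koszul_den_def fs.span_span .
qed

text \<open>So the quotient complex embeds into the normal forms, and vanishing in it can be tested
  there.\<close>

lemma den_iff_to_nf:
  assumes "z \<in> dup_num k n"
  shows "z \<in> dup_den k n \<longleftrightarrow> lin_ext to_nf z = (0 :: _ \<Rightarrow>\<^sub>0 'k::field)"
  using of_nf_to_nf[OF assms] to_nf_den[of z k n] by auto

section \<open>The contraction on linear spans and the acyclicity of the complex\<close>

lemma nf_homotopy_in_span: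
  assumes "m \<in> fs.span (nf_gens k n)"
  shows "lin_ext nf_homotopy m \<in> fs.span (nf_gens (Suc k) n :: (_ \<Rightarrow>\<^sub>0 'k::field) set)"
proof (rule lin_ext_in_span[OF assms])
  fix s :: "_ \<Rightarrow>\<^sub>0 'k" assume "s \<in> nf_gens k n"
  then obtain w ys where s: "s = Poly_Mapping.single (w, ys) 1" "dup_word w" "Suc (length w) = k"
    "length ys = k" "Leaf \<notin> set ys" "sum_list (map size ys) = n"
    by (auto simp: nf_gens_def)
  then obtain y zs where ys: "ys = y # zs" by (cases ys) auto
  show "lin_ext nf_homotopy s \<in> fs.span (nf_gens (Suc k) n)"
  proof (cases "split_first w y")
    case None
    then show ?thesis by (simp add: s(1) ys fs.span_zero)
  next
    case (Some p)
    then obtain g u v where split: "split_first w y = Some (g, u, v)" by (cases p) auto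
    have "size y = size u + size v"
      using split_first_SomeD[OF split] size_dup_mult[of g u v] by simp
    then have "Poly_Mapping.single (g # w, u # v # zs) 1 \<in> nf_gens (Suc k) n"
      unfolding nf_gens_def
      using s ys split_first_SomeD[OF split] split_first_dup_word[OF split]
      by (intro CollectI exI[of _ "g # w"] exI[of _ "u # v # zs"]) auto
    then show ?thesis using split by (auto simp: s(1) ys intro: fs.span_base)
  qed
qed

lemma nf_contraction:
  assumes "m \<in> fs.span (nf_gens k n)" "n \<ge> 2"
  shows "lin_ext nf_diff (lin_ext nf_homotopy m) + lin_ext nf_homotopy (lin_ext nf_diff m) = (m :: _ \<Rightarrow>\<^sub>0 'k::field)"
proof -
  have "lin_ext (\<lambda>b. lin_ext nf_diff (nf_homotopy b) + lin_ext nf_homotopy (nf_diff b :: _ \<Rightarrow>\<^sub>0 'k)) m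
      = lin_ext (\<lambda>b. Poly_Mapping.single b 1) m"
  proof (rule lin_ext_eq_on_span[OF assms(1)])
    fix s :: "_ \<Rightarrow>\<^sub>0 'k" assume "s \<in> nf_gens k n"
    then obtain w ys where s: "s = Poly_Mapping.single (w, ys) 1" "dup_word w"
      "length ys = Suc (length w)" "Leaf \<notin> set ys" "sum_list (map size ys) = n"
      by (auto simp: nf_gens_def)
    \<comment> \<open>The exceptional element has arity 1, which \<open>n \<ge> 2\<close> rules
      out.\<close>
    have "w \<noteq> [] \<or> hd ys \<noteq> Node Leaf () Leaf"
      using s assms(2) by (cases ys) auto
    with s show "lin_ext (\<lambda>b. lin_ext nf_diff (nf_homotopy b) + lin_ext nf_homotopy (nf_diff b :: _ \<Rightarrow>\<^sub>0 'k)) s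
      = lin_ext (\<lambda>b. Poly_Mapping.single b 1) s"
      by (simp add: nf_diff_homotopy)
  qed
  then show ?thesis by (simp add: lin_ext_fun_add lin_ext_id lin_ext_lin_ext)
qed

lemma nf_diff_diff_zero:
  assumes "m \<in> fs.span (nf_gens k n)"
  shows "lin_ext nf_diff (lin_ext nf_diff m) = (0 :: _ \<Rightarrow>\<^sub>0 'k::field)"
proof -
  have "lin_ext (\<lambda>b. lin_ext nf_diff (nf_diff b :: _ \<Rightarrow>\<^sub>0 'k)) m = lin_ext (\<lambda>b. 0 :: _ \<Rightarrow>\<^sub>0 'k) m"
    using assms by (rule lin_ext_eq_on_span) (auto simp: nf_gens_def nf_diff_nf_diff)
  then show ?thesis by (simp add: lin_ext_lin_ext)
qed

lemma num_add: "y \<in> dup_num k n \<Longrightarrow> z \<in> dup_num k n \<Longrightarrow> y + z \<in> dup_num k n"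
  by (simp add: koszul_num_def fs.span_add)

lemma num_diff: "y \<in> dup_num k n \<Longrightarrow> z \<in> dup_num k n \<Longrightarrow> y - z \<in> dup_num k n"
  by (simp add: koszul_num_def fs.span_diff)

theorem theorem5p4p4:
  shows "koszul (dup_relators :: (dup_op tree \<Rightarrow>\<^sub>0 'k::field) set)"
  unfolding koszul_def
proof (intro allI impI equalityI subsetI)
  fix n k :: nat and z :: "dup_op tree \<times> dup_op tree list \<Rightarrow>\<^sub>0 'k"
  assume n: "n \<ge> 2" and "z \<in> koszul_cycles dup_relators k n"
  then have z: "z \<in> dup_num k n" "koszul_diff z \<in> dup_den (k - 1) n"
    by (auto simp: koszul_cycles_def)
  define m :: "dup_op list \<times> unit tree list \<Rightarrow>\<^sub>0 'k" where "m = lin_ext to_nf z"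
  \<comment> \<open>The bounding chain: the homotopy applied to the normal form of the cycle, lifted
    back to tensors of trees.\<close>
  define y where "y = lin_ext of_nf (lin_ext nf_homotopy m)"
  have m: "m \<in> fs.span (nf_gens k n)" unfolding m_def by (rule to_nf_in_span) (rule z)
  have hm: "lin_ext nf_homotopy m \<in> fs.span (nf_gens (Suc k) n)" by (rule nf_homotopy_in_span) (rule m)
  have y: "y \<in> dup_num (Suc k) n" unfolding y_def by (rule of_nf_in_num) (rule hm)
  have "lin_ext nf_diff m = 0" unfolding m_def using to_nf_diff[OF z(1)] to_nf_den[OF z(2)] by simp
  then have "lin_ext nf_diff (lin_ext nf_homotopy m) = m" using nf_contraction[OF m n] by simp
  then have "lin_ext to_nf (koszul_diff y) = m"
    by (simp add: to_nf_diff[OF y]) (simp add: y_def to_nf_of_nf[OF hm])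
  then have "lin_ext to_nf (z - koszul_diff y) = (0 :: _ \<Rightarrow>\<^sub>0 'k)"
    by (simp add: lin_ext_linear m_def)
  moreover have "z - koszul_diff y \<in> dup_num k n"
    using num_diff z(1) koszul_diff_in_num[OF y] by simp
  \<comment> \<open>The two agree on normal forms, so their difference is the denominator term of a
    boundary.\<close>
  ultimately have "z - koszul_diff y \<in> dup_den k n"
    by (simp add: den_iff_to_nf)
  moreover have "z = koszul_diff y + (z - koszul_diff y)" by simp
  ultimately show "z \<in> koszul_boundaries dup_relators k n"
    unfolding koszul_boundaries_def using y by blast
next
  fix n k :: nat and z :: "dup_op tree \<times> dup_op tree list \<Rightarrow>\<^sub>0 'k"
  assume "z \<in> koszul_boundaries dup_relators k n"
  then obtain y u where z: "z = koszul_diff y + u" and y: "y \<in> dup_num (Suc k) n" and u: "u \<in> dup_den k n"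
    by (auto simp: koszul_boundaries_def)
  have dy: "koszul_diff y \<in> dup_num k n" using koszul_diff_in_num[OF y] by simp
  then have zn: "z \<in> dup_num k n" unfolding z using u koszul_den_subset by (intro num_add) auto
  have "lin_ext to_nf z = lin_ext nf_diff (lin_ext to_nf y :: _ \<Rightarrow>\<^sub>0 'k)"
    by (simp add: z lin_ext_linear to_nf_diff[OF y] to_nf_den[OF u])
  \<comment> \<open>The square of the differential is zero on normal forms, hence zero modulo
    \<open>koszul_den\<close> on tensors of trees.\<close>
  then have "lin_ext to_nf (koszul_diff z) = (0 :: _ \<Rightarrow>\<^sub>0 'k)"
    by (simp add: to_nf_diff[OF zn] nf_diff_diff_zero[OF to_nf_in_span[OF y]])
  then have "koszul_diff z \<in> dup_den (k - 1) n"
    using den_iff_to_nf koszul_diff_in_num[OF zn] by blast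
  with zn show "z \<in> koszul_cycles dup_relators k n"
    by (simp add: koszul_cycles_def)
qed

end
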